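(* Let $d\ge2$ be an integer and let $f_d(n)$ denote the maximum number of unit $d\times d$ minors in a real $d\times n$ matrix without repeated columns. Then for every $\varepsilon>0$ and all $n\ge d$, $$n^{d-2/3}\lesssim_d f_d(n)\lesssim_{d,\varepsilon} n^{d-\frac{d}{d^2-d+1}+\varepsilon}.$$
   Context: A unit $d\times d$ minor of a $d\times n$ matrix is a $d\times d$ minor (determinant of the submatrix formed by $d$ of the columns) equal to $1$. The notation $A\lesssim_{a,b,\dots}B$ means $A\le CB$ for a constant $C>0$ depending only on the listed parameters. *)

theory Defs
  imports
    Complex_Main
    "Jordan_Normal_Form.Determinant"
    "Jordan_Normal_Form.DL_Submatrix"
begin

text \<open>
  A minor of maximal size is indexed by the set of its column indices; the selected columns
  keep their order, so each \<open>J\<close> yields a single signed determinant.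
\<close>

definition unit_minors :: "real mat \<Rightarrow> nat set set" where
  "unit_minors A =
     {J. J \<subseteq> {0..<dim_col A} \<and> card J = dim_row A \<and> det (submatrix A UNIV J) = 1}"

definition max_unit_minors :: "nat \<Rightarrow> nat \<Rightarrow> nat" where
  "max_unit_minors d n = Max {card (unit_minors A) | A. A \<in> carrier_mat d n \<and> distinct (cols A)}"

text \<open>For \<open>d \<ge> 1\<close> the maximum is taken over a finite nonempty set.\<close>

lemma card_unit_minors_le:
  assumes "A \<in> carrier_mat d n"
  shows "card (unit_minors A) \<le> n choose d"
proof -
  have "card (unit_minors A) \<le> card {J. J \<subseteq> {0..<n} \<and> card J = d}"
    using assms by (intro card_mono) (auto simp: unit_minors_def)
  then show ?thesis
    by (simp add: n_subsets)
qed

lemma finite_unit_minor_counts: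
  "finite {card (unit_minors A) | A. A \<in> carrier_mat d n \<and> distinct (cols A)}"
  by (rule finite_subset[of _ "{..n choose d}"]) (auto intro: card_unit_minors_le)

lemma unit_minor_counts_nonempty:
  assumes "d \<ge> 1"
  shows "{card (unit_minors A) | A. A \<in> carrier_mat d n \<and> distinct (cols A)} \<noteq> {}"
proof -
  define A :: "real mat" where "A = mat d n (\<lambda>(i, j). real j)"
  have A: "A \<in> carrier_mat d n"
    by (simp add: A_def)
  have "i = j" if "i < n" "j < n" "col A i = col A j" for i j
  proof -
    have "col A i $ 0 = col A j $ 0"
      using that by simp
    then show ?thesis
      using that assms by (simp add: A_def)
  qed
  then have "distinct (cols A)"
    using A by (auto simp: distinct_conv_nth)
  then show ?thesis
    using A by blast
qed

end

theory Submission
  imports Defs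
begin

text \<open>
  Both bounds count lists of \<open>d\<close> columns with determinant \<open>1\<close>.

  \<^bold>\<open>Lower bound.\<close> The extremal configuration of points and lines in the plane is put into the
  first two coordinates. The vectors \<open>(1/c, m/c)\<close> and \<open>(x, m x + c)\<close> span area \<open>1\<close>, which is the
  incidence of the point \<open>(x, m x + c)\<close> with the line of slope \<open>m\<close> and intercept \<open>c\<close>. With
  \<open>m, x\<close> of order \<open>k\<close> and \<open>c\<close> of order \<open>k^2\<close> there are of the order of \<open>k^3\<close> vectors and \<open>k^4\<close>
  incidences. Each further column is \<open>e_j + s e_0\<close> with \<open>k^3\<close> choices of \<open>s\<close>, and \<open>s\<close> does not
  influence the determinant. So \<open>n ~ k^3\<close> columns have
  \<open>k^4 * (k^3)^(d-2) = (k^3)^(d - 2/3)\<close> unit minors (\<open>many_unit_minors\<close>).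

  \<^bold>\<open>Upper bound.\<close> The number of lists of \<open>d\<close> vectors from an \<open>n\<close>-element set with a given
  nonzero determinant is \<open>O(n^(d - 2/(d+1)))\<close> (\<open>count_det_tuples\<close>). This is at most the
  exponent in the theorem, since \<open>2/(d+1) - d/(d^2-d+1)\<close> has the sign of \<open>(d-1)(d-2)\<close>.
  The proof is an induction on \<open>d\<close> that starts from the trivial case \<open>d = 1\<close>. Fix a
  threshold \<open>m\<close> and write \<open>u\<close> for the first vector of the list.

  \<^item> Heavy lists: some later vector \<open>x\<close> lies on a line \<open>x + R u\<close> with more than \<open>m\<close> points.
    The line gives the direction of \<open>u\<close>, and the determinant then gives its length. So a heavy
    list is determined by an incidence between a point and an \<open>m\<close>-rich line together with the
    \<open>d - 2\<close> remaining vectors. By the Szemeredi-Trotter theorem there are \<open>O(n^2/m^2 + n)\<close> such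
    incidences, so there are \<open>O(n^d/m^2)\<close> heavy lists when \<open>m^2 \<le> n\<close>
    (\<open>count_heavy_tuples\<close>).

  \<^item> Light lists: for a fixed \<open>u\<close>, projecting along \<open>u\<close> turns the other vectors into a list of
    \<open>d - 1\<close> vectors one dimension lower, again with a fixed determinant, but up to \<open>m\<close> points may
    have the same image. The points are split into \<open>m\<close> classes of about \<open>n/m\<close> points on which the
    projection is injective. The induction hypothesis applies to each choice of classes
    (\<open>count_light_tuples\<close>).

  The choice \<open>m ~ n^(1/(d+1))\<close> balances the two contributions.

  The Szemeredi-Trotter bound is needed for points of \<open>R^d\<close>. A generic linear map to the plane
  preserves the distinctness of the points and the non-collinearity of triples
  (\<open>generic_plane_projection\<close>). In the plane the bound follows from the crossing lemma by
  Szekely's argument (\<open>rich_lines_incidences\<close>): consecutive points on rich lines are joined by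
  an edge, and each pair of lines yields at most one crossing of edges. The crossing lemma in turn rests
  on the linear bound for the number of edges of a plane straight-line graph. That bound is
  obtained by a direct charging argument (\<open>sees_vertex\<close>), which avoids the faces of the graph
  and Euler's formula.
\<close>

section \<open>Plane straight-line graphs\<close>

text \<open>
  An edge \<open>((a, b), (s, t))\<close> is the part of the line \<open>y = a x + b\<close> over the interval from \<open>s\<close> to
  \<open>t\<close>. Lines are never vertical, so a line is determined by its slope and intercept, and "left",
  "right", "above" and "below" make sense for edges.
\<close>
type_synonym edge = "(real \<times> real) \<times> real \<times> real"

definition height :: "real \<times> real \<Rightarrow> real \<Rightarrow> real" where
  "height l x = fst l * x + snd l"

abbreviation lft :: "edge \<Rightarrow> real" where "lft e \<equiv> fst (snd e)"
abbreviation rgt :: "edge \<Rightarrow> real" where "rgt e \<equiv> snd (snd e)"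
abbreviation hgt :: "edge \<Rightarrow> real \<Rightarrow> real" where "hgt e \<equiv> height (fst e)"
abbreviation slope :: "edge \<Rightarrow> real" where "slope e \<equiv> fst (fst e)"

definition crossing :: "edge \<Rightarrow> edge \<Rightarrow> bool" where
  "crossing e f \<longleftrightarrow> e \<noteq> f \<and>
     (\<exists>x. lft e < x \<and> lft f < x \<and> x < rgt e \<and> x < rgt f \<and> hgt e x = hgt f x)"

lemma lines_meet_between:
  assumes "height l z < height l' z" "height l' y < height l y" "z < y"
  obtains x where "z < x" "x < y" "height l x = height l' x"
proof -
  define D where "D x = height l x - height l' x" for x
  have "\<exists>x. z \<le> x \<and> x \<le> y \<and> D x = 0"
    using assms by (intro IVT') (auto simp: D_def height_def intro!: continuous_intros)
  then obtain x where x: "z \<le> x" "x \<le> y" "D x = 0" by auto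
  have "x \<noteq> z" "x \<noteq> y" using assms x by (auto simp: D_def)
  then show ?thesis using that[of x] x by (auto simp: D_def)
qed

lemma lines_eqI:
  assumes "height l x = height l' x" "height l y = height l' y" "x \<noteq> y"
  shows "l = l'"
proof -
  have "(fst l - fst l') * (x - y) = 0"
    using assms by (simp add: height_def algebra_simps)
  then have "fst l = fst l'" using assms(3) by simp
  then show ?thesis using assms(1) by (simp add: height_def prod_eq_iff)
qed

lemma height_slope_left:
  assumes "height l x = height l' x" "height l y < height l' y" "x < y"
  shows "fst l < fst l'"
proof -
  have "(fst l' - fst l) * (y - x) > 0"
    using assms by (simp add: height_def algebra_simps)
  then show ?thesis using assms(3) by (simp add: zero_less_mult_iff)
qed

lemma height_above_right:
  assumes "height l x = height l' x" "fst l < fst l'" "x < y"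
  shows "height l y < height l' y"
proof -
  have "(fst l' - fst l) * (y - x) > 0" using assms by simp
  then show ?thesis using assms(1) by (simp add: height_def algebra_simps)
qed

lemma height_above_left:
  assumes "height l x = height l' x" "fst l' < fst l" "y < x"
  shows "height l y < height l' y"
proof -
  have "(fst l - fst l') * (x - y) > 0" using assms by simp
  then show ?thesis using assms(1) by (simp add: height_def algebra_simps)
qed

lemma finite_minimizer:
  fixes f :: "'a \<Rightarrow> real"
  assumes "finite S" "S \<noteq> {}"
  shows "\<exists>x\<in>S. \<forall>y\<in>S. f x \<le> f y"
  using arg_min_if_finite[OF assms, of f] by (meson not_less)

locale geometric_graph =
  fixes V :: "(real \<times> real) set" and E :: "edge set"
  assumes finite_V: "finite V" and finite_E: "finite E"
    and nondegenerate: "e \<in> E \<Longrightarrow> lft e < rgt e"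
    and left_end: "e \<in> E \<Longrightarrow> (lft e, hgt e (lft e)) \<in> V"
    and right_end: "e \<in> E \<Longrightarrow> (rgt e, hgt e (rgt e)) \<in> V"
    and no_inner_vertex: "\<lbrakk>e \<in> E; lft e < x; x < rgt e\<rbrakk>
    \<Longrightarrow> (x, hgt e x) \<notin> V"

locale plane_graph = geometric_graph +
  assumes no_crossing: "\<lbrakk>e \<in> E; f \<in> E\<rbrakk>
    \<Longrightarrow> \<not> crossing e f"
begin

lemma not_meet:
  assumes "e \<in> E" "f \<in> E" "lft e < x" "x < rgt e" "lft f < x" "x < rgt f" "hgt e x = hgt f x"
  shows "e = f"
  using no_crossing[OF assms(1,2)] assms(3-) unfolding crossing_def by blast

lemma same_left_end:
  assumes "e \<in> E" "f \<in> E" "lft e = lft f" "fst e = fst f"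
  shows "e = f"
proof -
  obtain x where "lft e < x" "x < min (rgt e) (rgt f)"
    using dense[of "lft e" "min (rgt e) (rgt f)"] nondegenerate[OF assms(1)] nondegenerate[OF assms(2)] assms(3) by auto
  then show ?thesis using not_meet[of e f x] assms by simp
qed

lemma same_right_end:
  assumes "e \<in> E" "f \<in> E" "rgt e = rgt f" "fst e = fst f"
  shows "e = f"
proof -
  obtain x where "x < rgt e" "x > max (lft e) (lft f)"
    using dense[of "max (lft e) (lft f)" "rgt e"] nondegenerate[OF assms(1)] nondegenerate[OF assms(2)] assms(3) by auto
  then show ?thesis using not_meet[of e f x] assms by simp
qed

text \<open>
  Let \<open>f\<close> be the edge that follows \<open>e\<close> in the order of slopes at the common left end. An edge \<open>h\<close>
  that is inside the wedge between \<open>e\<close> and \<open>f\<close> at some abscissa cannot leave the wedge when it is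
  followed to the left: it crosses neither side, it cannot pass through the apex, and it cannot
  start there because \<open>f\<close> is the next edge. So it ends inside the wedge.
\<close>
lemma left_end_in_wedge:
  assumes e: "e \<in> E" and f: "f \<in> E" and h: "h \<in> E"
    and ef: "lft f = lft e" "hgt f (lft e) = hgt e (lft e)"
    and next_edge: "\<And>h. \<lbrakk>h \<in> E; lft h = lft e; hgt h (lft e) = hgt e (lft e); slope e < slope h\<rbrakk>
                      \<Longrightarrow> slope f \<le> slope h"
    and y: "lft e < y" "y < rgt e" "y \<le> rgt f" "lft h < y" "y < rgt h"
    and between: "hgt e y < hgt h y" "hgt h y < hgt f y"
  shows "lft e < lft h \<and> hgt e (lft h) < hgt h (lft h) \<and> hgt h (lft h) < hgt f (lft h)"
proof -
  have he: "h \<noteq> e" "h \<noteq> f" using between by auto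
  \<comment> \<open>Left of \<open>y\<close>, the edge \<open>h\<close> stays weakly above \<open>e\<close> and weakly below \<open>f\<close>.\<close>
  have nb: "hgt e z \<le> hgt h z" if z: "lft e \<le> z" "lft h \<le> z" "z < y" for z
  proof (rule ccontr)
    assume "\<not> ?thesis"
    then obtain x where "z < x" "x < y" "hgt h x = hgt e x"
      using lines_meet_between[of "fst h" z "fst e" y] between z by auto
    then show False using not_meet[OF h e, of x] z y he by auto
  qed
  have na: "hgt h z \<le> hgt f z" if z: "lft e \<le> z" "lft h \<le> z" "z < y" for z
  proof (rule ccontr)
    assume "\<not> ?thesis"
    then obtain x where "z < x" "x < y" "hgt f x = hgt h x"
      using lines_meet_between[of "fst f" z "fst h" y] between z by auto
    then show False using not_meet[OF h f, of x] z y he ef by auto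
  qed
  show ?thesis
  proof (cases "lft h \<le> lft e")
    case True
    have eq: "hgt h (lft e) = hgt e (lft e)" using nb[of "lft e"] na[of "lft e"] True y ef by simp
    have "lft h = lft e"
    proof (rule ccontr)
      assume "lft h \<noteq> lft e"
      then have "(lft e, hgt h (lft e)) \<notin> V" using no_inner_vertex[OF h] True y by auto
      then show False using left_end[OF e] eq by simp
    qed
    then have "slope f \<le> slope h"
      using next_edge[OF h] eq height_slope_left[of "fst e" "lft e" "fst h" y] between y by simp
    moreover have "slope h < slope f"
      using height_slope_left[of "fst h" "lft e" "fst f" y] eq ef between y by simp
    ultimately show ?thesis by simp
  next
    case False
    then have "hgt e (lft h) \<noteq> hgt h (lft h)" "hgt f (lft h) \<noteq> hgt h (lft h)"
      using left_end[OF h] no_inner_vertex[OF e, of "lft h"] no_inner_vertex[OF f, of "lft h"] y ef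
      by auto
    then show ?thesis using nb[of "lft h"] na[of "lft h"] False y by auto
  qed
qed

text \<open>
  The steepest edge starting at each vertex, and the uppermost (least steep) edge ending at each
  vertex. Every other edge has a neighbour above it at both of its ends.
\<close>
definition "top_left = {e \<in> E. \<forall>f\<in>E. lft f = lft e \<and> hgt f (lft e) = hgt e (lft e) \<longrightarrow> slope f \<le> slope e}"
definition "top_right = {e \<in> E. \<forall>f\<in>E. rgt f = rgt e \<and> hgt f (rgt e) = hgt e (rgt e) \<longrightarrow> slope e \<le> slope f}"

text \<open>
  The vertex \<open>w\<close> is vertically above the interior of \<open>e\<close>, with no edge in between. So \<open>e\<close> is the
  first edge below \<open>w\<close>, and no other edge sees \<open>w\<close>.
\<close>
definition sees :: "edge \<Rightarrow> real \<times> real \<Rightarrow> bool" where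
  "sees e w \<longleftrightarrow> lft e < fst w \<and> fst w < rgt e \<and> hgt e (fst w) < snd w \<and>
     (\<forall>h\<in>E. lft h < fst w \<and> fst w < rgt h \<and> hgt h (fst w) < snd w \<longrightarrow> hgt h (fst w) \<le> hgt e (fst w))"

lemma card_top_left: "card top_left \<le> card V"
proof (rule card_inj_on_le[OF _ _ finite_V])
  show "inj_on (\<lambda>e. (lft e, hgt e (lft e))) top_left"
  proof (rule inj_onI)
    fix e f assume *: "e \<in> top_left" "f \<in> top_left" "(lft e, hgt e (lft e)) = (lft f, hgt f (lft f))"
    have "slope f \<le> slope e" "slope e \<le> slope f"
      using * unfolding top_left_def by auto
    then have "slope e = slope f" by simp
    then have "fst e = fst f" using * by (auto simp: height_def prod_eq_iff)
    then show "e = f" using same_left_end * unfolding top_left_def by auto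
  qed
qed (use left_end in \<open>auto simp: top_left_def\<close>)

lemma card_top_right: "card top_right \<le> card V"
proof (rule card_inj_on_le[OF _ _ finite_V])
  show "inj_on (\<lambda>e. (rgt e, hgt e (rgt e))) top_right"
  proof (rule inj_onI)
    fix e f assume *: "e \<in> top_right" "f \<in> top_right" "(rgt e, hgt e (rgt e)) = (rgt f, hgt f (rgt f))"
    have "slope f \<le> slope e" "slope e \<le> slope f"
      using * unfolding top_right_def by auto
    then have "slope e = slope f" by simp
    then have "fst e = fst f" using * by (auto simp: height_def prod_eq_iff)
    then show "e = f" using same_right_end * unfolding top_right_def by auto
  qed
qed (use right_end in \<open>auto simp: top_right_def\<close>)

text \<open>
  The wedge between \<open>e\<close> and the next edge \<open>f\<close> at the left end of \<open>e\<close>, cut off at the right end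
  of \<open>e\<close>, contains a vertex. It is the right end of \<open>f\<close> if \<open>f\<close> is short. If \<open>f\<close> is long, it is
  the left end of an edge \<open>g\<close> that lies above \<open>e\<close> and has the same right end. A leftmost vertex in
  the wedge is visible from \<open>e\<close>: an edge below it would have its left end in the wedge,
  further to the left.
\<close>
lemma sees_vertex:
  assumes e: "e \<in> E" and "e \<notin> top_left" "e \<notin> top_right"
  shows "\<exists>w\<in>V. sees e w"
proof -
  define F where "F = {f \<in> E. lft f = lft e \<and> hgt f (lft e) = hgt e (lft e) \<and> slope e < slope f}"
  have "finite F" "F \<noteq> {}" using finite_E assms unfolding F_def top_left_def by force+
  then obtain f where f: "f \<in> F" "\<And>h. h \<in> F \<Longrightarrow> slope f \<le> slope h"
    using finite_minimizer[of F slope] by blast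
  have fE: "f \<in> E" "lft f = lft e" "hgt f (lft e) = hgt e (lft e)" "slope e < slope f"
    using f(1) by (auto simp: F_def)
  have fmin: "slope f \<le> slope h"
    if "h \<in> E" "lft h = lft e" "hgt h (lft e) = hgt e (lft e)" "slope e < slope h" for h
    using f(2) that by (auto simp: F_def)
  obtain g where g: "g \<in> E" "rgt g = rgt e" "hgt g (rgt e) = hgt e (rgt e)" "slope g < slope e"
    using assms unfolding top_right_def by force
  define R where "R = {w \<in> V. lft e < fst w \<and> fst w < rgt e \<and> fst w \<le> rgt f \<and>
                         hgt e (fst w) < snd w \<and> snd w \<le> hgt f (fst w)}"
  have wedge: "lft e < lft h \<and> hgt e (lft h) < hgt h (lft h) \<and> hgt h (lft h) < hgt f (lft h)"
    if "h \<in> E" "lft e < y" "y < rgt e" "y \<le> rgt f" "lft h < y" "y < rgt h" "hgt e y < hgt h y" "hgt h y < hgt f y"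
    for h y
    using that by (intro left_end_in_wedge[OF e fE(1) _ fE(2,3)] fmin) auto
  have le: "lft e < rgt e" "lft e < rgt f" "lft g < rgt e"
    using nondegenerate[OF e] nondegenerate[OF fE(1)] nondegenerate[OF g(1)] fE(2) g(2) by auto
  have "R \<noteq> {}"
  proof (cases "rgt f < rgt e")
    case True
    then have "(rgt f, hgt f (rgt f)) \<in> R"
      using right_end[OF fE(1)] le height_above_right[OF fE(3)[symmetric] fE(4) le(2)]
      by (simp add: R_def)
    then show ?thesis by auto
  next
    case False
    define z where "z = max (lft e) (lft g)"
    have ftop: "hgt e (rgt e) < hgt f (rgt e)"
      using height_above_right[OF fE(3)[symmetric] fE(4) le(1)] .
    \<comment> \<open>Just left of the right end of \<open>e\<close>, the edge \<open>g\<close> is inside the wedge. On the common range of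
      \<open>f\<close> and \<open>g\<close> it then lies below \<open>f\<close> throughout, as the two do not cross.\<close>
    have "\<exists>y. z < y \<and> y < rgt e \<and> hgt g y < hgt f y"
    proof (cases "hgt g z < hgt f z")
      case True
      obtain y where y: "z < y" "y < rgt e" using dense[of z "rgt e"] le by (auto simp: z_def)
      have "hgt g y < hgt f y"
      proof (rule ccontr)
        assume "\<not> ?thesis"
        then consider "hgt f y < hgt g y" | "hgt f y = hgt g y" by linarith
        then show False
        proof cases
          case 1
          then obtain x where x: "z < x" "x < y" "hgt g x = hgt f x"
            using lines_meet_between[of "fst g" z "fst f" y] True y by auto
          then show False using not_meet[OF g(1) fE(1), of x] y False g fE by (auto simp: z_def)
        next
          case 2
          then show False using not_meet[OF g(1) fE(1), of y] y False g fE by (auto simp: z_def)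
        qed
      qed
      then show ?thesis using y by auto
    next
      case nl: False
      show ?thesis
      proof (cases "hgt f z = hgt g z")
        case True
        obtain y where y: "z < y" "y < rgt e" using dense[of z "rgt e"] le by (auto simp: z_def)
        have "fst (fst g) < fst (fst f)" using fE g by simp
        then show ?thesis using height_above_right[of "fst g" z "fst f" y] True y by auto
      next
        case nt: False
        then have "hgt f z < hgt g z" using nl by simp
        then obtain x where x: "z < x" "x < rgt e" "hgt f x = hgt g x"
          using lines_meet_between[of "fst f" z "fst g" "rgt e"] ftop g le by (auto simp: z_def)
        then have False using not_meet[OF g(1) fE(1), of x] False g fE by (auto simp: z_def)
        then show ?thesis by simp
      qed
    qed
    then obtain y where y: "z < y" "y < rgt e" "hgt g y < hgt f y" by auto
    have "hgt e y < hgt g y" using height_above_left[of "fst e" "rgt e" "fst g" y] g y by simp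
    then have "lft e < lft g \<and> hgt e (lft g) < hgt g (lft g) \<and> hgt g (lft g) < hgt f (lft g)"
      using wedge[OF g(1), of y] y False g by (auto simp: z_def)
    then have "(lft g, hgt g (lft g)) \<in> R" using left_end[OF g(1)] le False
      by (auto simp: R_def)
    then show ?thesis by auto
  qed
  moreover have "finite R" using finite_V by (simp add: R_def)
  ultimately obtain w where w: "w \<in> R" "\<And>v. v \<in> R \<Longrightarrow> fst w \<le> fst v"
    using finite_minimizer[of R fst] by blast
  have "hgt h (fst w) \<le> hgt e (fst w)"
    if h: "h \<in> E" "lft h < fst w" "fst w < rgt h" "hgt h (fst w) < snd w" for h
  proof (rule ccontr)
    assume "\<not> ?thesis"
    then have "lft e < lft h \<and> hgt e (lft h) < hgt h (lft h) \<and> hgt h (lft h) < hgt f (lft h)"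
      using wedge[OF h(1), of "fst w"] h w(1) by (auto simp: R_def)
    then have "(lft h, hgt h (lft h)) \<in> R" using left_end[OF h(1)] h w(1) by (auto simp: R_def)
    then show False using w(2) h(2) by force
  qed
  then have "sees e w" using w(1) by (auto simp: sees_def R_def)
  then show ?thesis using w(1) by (auto simp: R_def)
qed

text \<open>
  At most \<open>card V\<close> edges are topmost at their left end, at most \<open>card V\<close> are topmost at their
  right end, and the others are charged injectively to vertices that they see.
\<close>
theorem card_edges_le: "card E \<le> 3 * card V"
proof -
  define T where "T = E - top_left - top_right"
  define w where "w e = (SOME w. w \<in> V \<and> sees e w)" for e
  have w: "w e \<in> V \<and> sees e (w e)" if "e \<in> T" for e
    unfolding w_def by (rule someI_ex) (use sees_vertex[of e] that in \<open>auto simp: T_def\<close>)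
  have "card T \<le> card V"
  proof (rule card_inj_on_le[OF _ _ finite_V])
    show "inj_on w T"
    proof (rule inj_onI)
      fix e f assume *: "e \<in> T" "f \<in> T" "w e = w f"
      have s: "sees e (w e)" "sees f (w e)" and E: "e \<in> E" "f \<in> E" using w[of e] w[of f] *
        by (auto simp: T_def)
      have "hgt e (fst (w e)) = hgt f (fst (w e))"
      proof (rule antisym)
        show "hgt e (fst (w e)) \<le> hgt f (fst (w e))" using s E(1) unfolding sees_def by blast
        show "hgt f (fst (w e)) \<le> hgt e (fst (w e))" using s E(2) unfolding sees_def by blast
      qed
      then show "e = f" using not_meet[OF E, of "fst (w e)"] s unfolding sees_def by auto
    qed
  qed (use w in auto)
  moreover have "E \<subseteq> T \<union> (top_left \<union> top_right)" by (auto simp: T_def)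
  then have "card E \<le> card (T \<union> (top_left \<union> top_right))"
    using finite_E by (intro card_mono) (auto simp: T_def top_left_def top_right_def)
  moreover have "\<dots> \<le> card T + (card top_left + card top_right)"
    by (meson card_Un_le add_left_mono le_trans)
  ultimately show ?thesis using card_top_left card_top_right by linarith
qed

end

section \<open>Crossings, and incidences with rich lines\<close>

abbreviation lend :: "edge \<Rightarrow> real \<times> real" where "lend e \<equiv> (lft e, hgt e (lft e))"
abbreviation rend :: "edge \<Rightarrow> real \<times> real" where "rend e \<equiv> (rgt e, hgt e (rgt e))"

definition crossings :: "edge set \<Rightarrow> (edge \<times> edge) set" where
  "crossings E = {(e, f). e \<in> E \<and> f \<in> E \<and> crossing e f}"

lemma finite_crossings: "finite E \<Longrightarrow> finite (crossings E)"
  by (rule finite_subset[of _ "E \<times> E"]) (auto simp: crossings_def)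

lemma (in geometric_graph) subgraph:
  assumes "V' \<subseteq> V" "E' \<subseteq> E" "\<And>e. e \<in> E'
    \<Longrightarrow> lend e \<in> V' \<and> rend e \<in> V'"
  shows "geometric_graph V' E'"
proof
  fix e x assume "e \<in> E'" "lft e < x" "x < rgt e"
  then show "(x, hgt e x) \<notin> V'" using no_inner_vertex[of e x] assms by blast
qed (use assms finite_V finite_E nondegenerate in \<open>auto dest: finite_subset\<close>)

text \<open>
  Deleting one edge from each crossing pair leaves a plane graph.
\<close>
lemma card_edges_le_crossings:
  assumes "geometric_graph V E"
  shows "card E \<le> 3 * card V + card (crossings E)"
  using assms
proof (induction "card E" arbitrary: E rule: less_induct)
  case less
  interpret geometric_graph V E by fact
  show ?case
  proof (cases "crossings E = {}")
    case True
    then interpret plane_graph V E by unfold_locales (auto simp: crossings_def)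
    show ?thesis using card_edges_le by simp
  next
    case False
    then obtain e f where ef: "(e, f) \<in> crossings E" by auto
    then have e: "e \<in> E" by (simp add: crossings_def)
    define E' where "E' = E - {e}"
    have card: "card E = Suc (card E')" using e finite_E unfolding E'_def by (metis card_Suc_Diff1)
    have "geometric_graph V E'"
      using subgraph[of V E'] left_end right_end by (auto simp: E'_def)
    then have "card E' \<le> 3 * card V + card (crossings E')" using less card by simp
    moreover have "crossings E' \<subset> crossings E"
      using ef by (auto simp: E'_def crossings_def)
    then have "card (crossings E') < card (crossings E)"
      using finite_crossings[OF finite_E] by (simp add: psubset_card_mono)
    ultimately show ?thesis using card by simp
  qed
qed

text \<open>
  Edges on a common line with a common end coincide, because no vertex is interior to an edge.
  Hence the ends of crossing edges are four distinct vertices, which is what makes the crossings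
  rarer than the edges under sampling.
\<close>
lemma (in geometric_graph) crossing_ends:
  assumes e: "e \<in> E" and f: "f \<in> E" and "crossing e f"
  shows "card {lend e, rend e, lend f, rend f} = 4"
proof -
  obtain x where ne: "e \<noteq> f"
    and x: "lft e < x" "lft f < x" "x < rgt e" "x < rgt f" "hgt e x = hgt f x"
    using assms(3) unfolding crossing_def by blast
  have "lend e \<noteq> lend f"
  proof
    assume *: "lend e = lend f"
    then have "lft e = lft f" "hgt e (lft e) = hgt f (lft e)" by auto
    then have l: "fst e = fst f" using lines_eqI[of "fst e" "lft e" "fst f" x] x by auto
    then have "rgt e = rgt f"
      using no_inner_vertex[OF e, of "rgt f"] no_inner_vertex[OF f, of "rgt e"]
        right_end[OF e] right_end[OF f] x by force
    then show False using ne l * by (simp add: prod_eq_iff)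
  qed
  moreover have "rend e \<noteq> rend f"
  proof
    assume *: "rend e = rend f"
    then have "rgt e = rgt f" "hgt e (rgt e) = hgt f (rgt e)" by auto
    then have l: "fst e = fst f" using lines_eqI[of "fst e" "rgt e" "fst f" x] x by auto
    then have "lft e = lft f"
      using no_inner_vertex[OF e, of "lft f"] no_inner_vertex[OF f, of "lft e"]
        left_end[OF e] left_end[OF f] x by force
    then show False using ne l * by (simp add: prod_eq_iff)
  qed
  ultimately show ?thesis using x by auto
qed

lemma sum_card_swap:
  assumes "finite A" "finite B"
  shows "(\<Sum>a\<in>A. card {b \<in> B. P a b}) = (\<Sum>b\<in>B. card {a \<in> A. P a b})"
proof -
  have "(\<Sum>a\<in>A. card {b \<in> B. P a b}) = (\<Sum>a\<in>A. \<Sum>b\<in>B. if P a b then 1 else 0)"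
    using assms by (simp add: sum.If_cases Int_def)
  also have "\<dots> = (\<Sum>b\<in>B. \<Sum>a\<in>A. if P a b then 1 else 0)" by (rule sum.swap)
  also have "\<dots> = (\<Sum>b\<in>B. card {a \<in> A. P a b})"
    using assms by (simp add: sum.If_cases Int_def)
  finally show ?thesis .
qed

lemma card_colourings_vanishing:
  fixes k :: nat
  assumes "finite V" "T \<subseteq> V" "k \<ge> 1"
  shows "real (card {c \<in> V \<rightarrow>\<^sub>E {..<k}. \<forall>v\<in>T. c v = 0}) = real k ^ card V / real k ^ card T"
proof -
  have "{c \<in> V \<rightarrow>\<^sub>E {..<k}. \<forall>v\<in>T. c v = 0} = (\<Pi>\<^sub>E v\<in>V. if v \<in> T then {0} else {..<k})"
  proof (intro equalityI subsetI)
    fix c assume "c \<in> {c \<in> V \<rightarrow>\<^sub>E {..<k}. \<forall>v\<in>T. c v = 0}"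
    then show "c \<in> (\<Pi>\<^sub>E v\<in>V. if v \<in> T then {0} else {..<k})"
      by (simp add: PiE_iff)
  next
    fix c assume "c \<in> (\<Pi>\<^sub>E v\<in>V. if v \<in> T then {0} else {..<k})"
    then have c: "c \<in> extensional V" "\<forall>v\<in>V. c v \<in> (if v \<in> T then {0} else {..<k})"
      by (auto simp: PiE_iff)
    then have "c v = 0" if "v \<in> T" for v using that assms(2) by force
    moreover have "c v < k" if "v \<in> V" for v using that c(2) assms(3)
      by (cases "v \<in> T") force+
    ultimately show "c \<in> {c \<in> V \<rightarrow>\<^sub>E {..<k}. \<forall>v\<in>T. c v = 0}"
      using c(1) by (auto simp: PiE_iff)
  qed
  then have "card {c \<in> V \<rightarrow>\<^sub>E {..<k}. \<forall>v\<in>T. c v = 0} = (\<Prod>v\<in>V. card (if v \<in> T then {0} else {..<k}))"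
    by (simp only: card_PiE[OF assms(1)])
  also have "\<dots> = (\<Prod>v\<in>V. if v \<in> T then 1 else k)" by (intro prod.cong) auto
  also have "\<dots> = k ^ card (V - T)"
    using assms by (simp add: prod.If_cases Diff_eq)
  also have "card (V - T) = card V - card T" using assms
    by (simp add: card_Diff_subset finite_subset)
  also have "real (k ^ (card V - card T)) = real k ^ card V / real k ^ card T"
    unfolding of_nat_power using assms card_mono[of V T] by (intro power_diff) auto
  finally show ?thesis .
qed

text \<open>
  The linear bound is applied to the subgraph on a random set of vertices, namely the vertices
  of colour \<open>0\<close> in a colouring with \<open>k\<close> colours. On average over all colourings, a vertex, an edge
  and a crossing survive with probability \<open>1/k\<close>, \<open>1/k^2\<close> and \<open>1/k^4\<close>; the inequality is multiplied
  by \<open>k^4\<close>.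
\<close>
lemma (in geometric_graph) crossings_sampled:
  fixes k :: nat
  assumes "k \<ge> 1"
  shows "real (card E) * k ^ 2 \<le> 3 * real (card V) * k ^ 3 + card (crossings E)"
proof -
  define C where "C = (V \<rightarrow>\<^sub>E {..<k})"
  have C: "finite C" unfolding C_def using finite_V by (intro finite_PiE) auto
  define ends where "ends e = {lend e, rend e}" for e
  have "card {e \<in> E. \<forall>v\<in>ends e. c v = 0} \<le> 3 * card {v \<in> V. \<forall>u\<in>{v}. c u = 0}
           + card {p \<in> crossings E. \<forall>v\<in>ends (fst p) \<union> ends (snd p). c v = 0}" for c :: "_ \<Rightarrow> nat"
  proof -
    have "geometric_graph {v \<in> V. \<forall>u\<in>{v}. c u = 0} {e \<in> E. \<forall>v\<in>ends e. c v = 0}"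
      using left_end right_end by (intro subgraph) (auto simp: ends_def)
    from card_edges_le_crossings[OF this]
    have "card {e \<in> E. \<forall>v\<in>ends e. c v = 0} \<le> 3 * card {v \<in> V. \<forall>u\<in>{v}. c u = 0}
             + card (crossings {e \<in> E. \<forall>v\<in>ends e. c v = 0})" .
    also have "crossings {e \<in> E. \<forall>v\<in>ends e. c v = 0}
       = {p \<in> crossings E. \<forall>v\<in>ends (fst p) \<union> ends (snd p). c v = 0}"
      by (auto simp: crossings_def)
    finally show ?thesis .
  qed
  then have "(\<Sum>c\<in>C. card {e \<in> E. \<forall>v\<in>ends e. c v = 0})
     \<le> (\<Sum>c\<in>C. 3 * card {v \<in> V. \<forall>u\<in>{v}. c u = 0}
           + card {p \<in> crossings E. \<forall>v\<in>ends (fst p) \<union> ends (snd p). c v = 0})"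
    by (intro sum_mono)
  then have "(\<Sum>e\<in>E. card {c \<in> C. \<forall>v\<in>ends e. c v = 0})
     \<le> 3 * (\<Sum>v\<in>V. card {c \<in> C. \<forall>u\<in>{v}. c u = 0})
           + (\<Sum>p\<in>crossings E. card {c \<in> C. \<forall>v\<in>ends (fst p) \<union> ends (snd p). c v = 0})"
    unfolding sum.distrib sum_distrib_left[symmetric]
      sum_card_swap[OF C finite_V] sum_card_swap[OF C finite_E]
      sum_card_swap[OF C finite_crossings[OF finite_E]] .
  then have "real (\<Sum>e\<in>E. card {c \<in> C. \<forall>v\<in>ends e. c v = 0})
     \<le> real (3 * (\<Sum>v\<in>V. card {c \<in> C. \<forall>u\<in>{v}. c u = 0})
           + (\<Sum>p\<in>crossings E. card {c \<in> C. \<forall>v\<in>ends (fst p) \<union> ends (snd p). c v = 0}))"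
    by (simp only: of_nat_le_iff)
  then have "(\<Sum>e\<in>E. real (card {c \<in> C. \<forall>v\<in>ends e. c v = 0}))
     \<le> 3 * (\<Sum>v\<in>V. real (card {c \<in> C. \<forall>u\<in>{v}. c u = 0}))
           + (\<Sum>p\<in>crossings E. real (card {c \<in> C. \<forall>v\<in>ends (fst p) \<union> ends (snd p). c v = 0}))"
    by simp
  also have "(\<Sum>e\<in>E. real (card {c \<in> C. \<forall>v\<in>ends e. c v = 0})) = (\<Sum>e\<in>E. real k ^ card V / real k ^ 2)"
  proof (rule sum.cong[OF refl])
    fix e assume e: "e \<in> E"
    have "card (ends e) = 2" using nondegenerate[OF e] by (simp add: ends_def)
    then show "real (card {c \<in> C. \<forall>v\<in>ends e. c v = 0}) = real k ^ card V / real k ^ 2"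
      unfolding C_def using card_colourings_vanishing[OF finite_V _ assms, of "ends e"] left_end[OF e] right_end[OF e]
      by (simp add: ends_def)
  qed
  also have "(\<Sum>v\<in>V. real (card {c \<in> C. \<forall>u\<in>{v}. c u = 0})) = (\<Sum>v\<in>V. real k ^ card V / real k)"
    unfolding C_def using card_colourings_vanishing[OF finite_V _ assms, of "{_}"]
    by (intro sum.cong) simp_all
  also have "(\<Sum>p\<in>crossings E. real (card {c \<in> C. \<forall>v\<in>ends (fst p) \<union> ends (snd p). c v = 0}))
     = (\<Sum>p\<in>crossings E. real k ^ card V / real k ^ 4)"
  proof (rule sum.cong[OF refl])
    fix p assume p: "p \<in> crossings E"
    then have E: "fst p \<in> E" "snd p \<in> E" "crossing (fst p) (snd p)"
      by (auto simp: crossings_def)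
    have "ends (fst p) \<union> ends (snd p) = {lend (fst p), rend (fst p), lend (snd p), rend (snd p)}"
      by (auto simp: ends_def)
    then have "card (ends (fst p) \<union> ends (snd p)) = 4" using crossing_ends[OF E] by simp
    then show "real (card {c \<in> C. \<forall>v\<in>ends (fst p) \<union> ends (snd p). c v = 0}) = real k ^ card V / real k ^ 4"
      unfolding C_def
      using card_colourings_vanishing[OF finite_V _ assms, of "ends (fst p) \<union> ends (snd p)"]
        left_end E right_end by (simp add: ends_def)
  qed
  finally have *: "real (card E) * (real k ^ card V / real k ^ 2)
      \<le> 3 * (real (card V) * (real k ^ card V / real k)) + real (card (crossings E)) * (real k ^ card V / real k ^ 4)"
    by simp
  have k: "real k > 0" using assms by simp
  have "real k ^ 4 / real k ^ card V * (real (card E) * (real k ^ card V / real k ^ 2))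
     \<le> real k ^ 4 / real k ^ card V * (3 * (real (card V) * (real k ^ card V / real k)) + real (card (crossings E)) * (real k ^ card V / real k ^ 4))"
    using * by (intro mult_left_mono) auto
  moreover have "real k ^ 4 / real k ^ card V * (real (card E) * (real k ^ card V / real k ^ 2)) = real (card E) * k ^ 2"
    using k by (simp add: field_simps power2_eq_square power4_eq_xxxx)
  moreover have "real k ^ 4 / real k ^ card V * (3 * (real (card V) * (real k ^ card V / real k)) + real (card (crossings E)) * (real k ^ card V / real k ^ 4))
    = 3 * real (card V) * k ^ 3 + card (crossings E)"
    using k by (simp add: field_simps power3_eq_cube power4_eq_xxxx)
  ultimately show ?thesis by simp
qed

text \<open>
  The number \<open>k\<close> of colours is chosen close to \<open>card E / (4 * card V)\<close>, so that the vertices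
  account for at most three quarters of the term for the edges.
\<close>
lemma (in geometric_graph) crossing_lemma:
  assumes "4 * card V \<le> card E" 
  shows "real (card E) ^ 3 \<le> 256 * real (card V) ^ 2 * card (crossings E)"
proof (cases "card V = 0")
  case True
  then have "V = {}" using finite_V by simp
  then have "E = {}" using left_end by auto
  then show ?thesis by simp
next
  case False
  define e n k X where "e = real (card E)" and "n = real (card V)" and "k = card E div (4 * card V)"
    and "X = real (card (crossings E))"
  have n: "n > 0" using False by (simp add: n_def)
  have k1: "k \<ge> 1" using assms False by (simp add: k_def Suc_leI div_greater_zero_iff)
  have "4 * card V * k \<le> card E" by (simp add: k_def)
  then have "real (4 * card V * k) \<le> real (card E)" by (simp only: of_nat_le_iff)
  then have le: "4 * n * k \<le> e" by (simp add: n_def e_def)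
  have "card E \<le> 4 * card V * (k + 1)"
    using dividend_less_times_div[of "4 * card V" "card E"] False by (simp add: k_def algebra_simps)
  also have "\<dots> \<le> 4 * card V * (2 * k)" using k1 by (intro mult_le_mono) auto
  finally have "real (card E) \<le> real (4 * card V * (2 * k))" by (simp only: of_nat_le_iff)
  then have ge: "e \<le> 8 * n * k" by (simp add: n_def e_def)
  have "e * real k ^ 2 \<le> 3 * n * real k ^ 3 + X"
    using crossings_sampled[OF k1] by (simp add: e_def n_def X_def)
  moreover have "3 * n * real k ^ 3 = 3 / 4 * (4 * n * k) * real k ^ 2"
    by (simp add: power2_eq_square power3_eq_cube)
  moreover have "\<dots> \<le> 3 / 4 * e * real k ^ 2" using le by (intro mult_right_mono) auto
  ultimately have "e * real k ^ 2 \<le> 4 * X" by linarith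
  then have X: "64 * n ^ 2 * (e * real k ^ 2) \<le> 64 * n ^ 2 * (4 * X)"
    by (intro mult_left_mono) auto
  have "e ^ 3 = e * e ^ 2" by (simp add: power3_eq_cube power2_eq_square)
  also have "\<dots> \<le> e * (8 * n * k) ^ 2"
    using ge by (intro mult_left_mono power_mono) (auto simp: e_def)
  also have "\<dots> = 64 * n ^ 2 * (e * real k ^ 2)" by (simp add: power_mult_distrib)
  also have "\<dots> \<le> 256 * n ^ 2 * X" using X by simp
  finally show ?thesis by (simp add: e_def n_def X_def)
qed

text \<open>
  A non-vertical line meets \<open>P\<close> in as many points as there are abscissae of such points.
\<close>
definition abscissae :: "(real \<times> real) set \<Rightarrow> real \<times> real \<Rightarrow> real set" where
  "abscissae P l = {x. (x, height l x) \<in> P}"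

definition rich_lines :: "(real \<times> real) set \<Rightarrow> nat \<Rightarrow> (real \<times> real) set" where
  "rich_lines P m = {l. m < card (abscissae P l)}"

lemma finite_abscissae: "finite P \<Longrightarrow> finite (abscissae P l)"
  by (rule finite_subset[of _ "fst ` P"]) (force simp: abscissae_def)+

lemma finite_rich_lines:
  assumes "finite P" "m \<ge> 1"
  shows "finite (rich_lines P m)"
proof -
  define f where "f p q = (THE l. height l (fst p) = snd p \<and> height l (fst q) = snd q)" for p q
  have "rich_lines P m \<subseteq> (\<lambda>(p, q). f p q) ` (P \<times> P)"
  proof
    fix l assume "l \<in> rich_lines P m"
    then have "card (abscissae P l) \<ge> 2" using assms by (simp add: rich_lines_def)
    then obtain x y where xy: "x \<noteq> y" "x \<in> abscissae P l" "y \<in> abscissae P l"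
      by (metis (no_types, opaque_lifting) card_le_Suc0_iff_eq card.infinite not_less_eq_eq numeral_2_eq_2 zero_le)
    have "f (x, height l x) (y, height l y) = l"
      unfolding f_def using xy(1) by (intro the_equality) (auto intro: lines_eqI)
    then show "l \<in> (\<lambda>(p, q). f p q) ` (P \<times> P)"
      using xy by (force simp: abscissae_def)
  qed
  then show ?thesis using assms by (meson finite_SigmaI finite_imageI finite_subset)
qed

text \<open>
  Consecutive points on each rich line are joined by an edge. A line with \<open>c > m \<ge> 1\<close> points
  carries \<open>c - 1\<close> edges, which is at least \<open>c/2\<close> and at least \<open>m\<close>. So the number \<open>e\<close> of edges
  bounds both the incidences and \<open>m\<close> times the number of lines. Two lines meet at most once, so
  there are at most \<open>(e/m)^2\<close> crossings, and the crossing lemma bounds \<open>e\<close>.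
\<close>
theorem rich_lines_incidences:
  assumes P: "finite P" and m: "m \<ge> 1"
  shows "real (\<Sum>l\<in>rich_lines P m. card (abscissae P l))
           \<le> 512 * real (card P) ^ 2 / real m ^ 2 + 8 * card P"
proof -
  define L where "L = rich_lines P m"
  note fA = finite_abscissae[OF P]
  have L: "finite L" unfolding L_def using finite_rich_lines[OF P m] .
  define E where "E = {(l, s, t). l \<in> L \<and> s \<in> abscissae P l \<and> t \<in> abscissae P l \<and> s < t \<and>
                        (\<forall>u\<in>abscissae P l. \<not> (s < u \<and> u < t))}"
  have "E \<subseteq> L \<times> fst ` P \<times> fst ` P" by (force simp: E_def abscissae_def)
  then have fE: "finite E" using L P by (meson finite_SigmaI finite_imageI finite_subset)
  interpret geometric_graph P E
    by unfold_locales (use P fE in \<open>auto simp: E_def abscissae_def\<close>)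
  \<comment> \<open>Each point on a rich line, except the last one, is joined to its successor.\<close>
  have "card (SIGMA l:L. abscissae P l - {Max (abscissae P l)}) \<le> card E"
  proof (rule card_inj_on_le[OF _ _ fE])
    show "inj_on (\<lambda>(l, s). (l, s, Min {t \<in> abscissae P l. s < t})) (SIGMA l:L. abscissae P l - {Max (abscissae P l)})"
      by (auto simp: inj_on_def)
    show "(\<lambda>(l, s). (l, s, Min {t \<in> abscissae P l. s < t})) ` (SIGMA l:L. abscissae P l - {Max (abscissae P l)}) \<subseteq> E"
    proof (rule image_subsetI)
      fix p assume "p \<in> (SIGMA l:L. abscissae P l - {Max (abscissae P l)})"
      then obtain l s where p: "p = (l, s)" and l: "l \<in> L"
        and s: "s \<in> abscissae P l" "s \<noteq> Max (abscissae P l)" by auto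
      let ?T = "{t \<in> abscissae P l. s < t}"
      have "finite ?T" using fA by simp
      moreover have "Max (abscissae P l) \<in> ?T"
        using s fA by (metis (mono_tags, lifting) Max_ge Max_in empty_iff mem_Collect_eq order_le_neq_trans)
      ultimately have "Min ?T \<in> ?T" "\<And>u. u \<in> ?T \<Longrightarrow> Min ?T \<le> u" 
        using Min_in[of ?T] Min_le[of ?T] by blast+
      then have "(l, s, Min ?T) \<in> E" using l s by (force simp: E_def)
      then show "(case p of (l, s) \<Rightarrow> (l, s, Min {t \<in> abscissae P l. s < t})) \<in> E" using p by simp
    qed
  qed
  moreover have "card (SIGMA l:L. abscissae P l - {Max (abscissae P l)}) = (\<Sum>l\<in>L. card (abscissae P l) - 1)"
  proof -
    have "card (abscissae P l - {Max (abscissae P l)}) = card (abscissae P l) - 1"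
      if "l \<in> L" for l
    proof -
      have "abscissae P l \<noteq> {}" using that m by (auto simp: L_def rich_lines_def)
      then show ?thesis using fA by simp
    qed
    then show ?thesis using L fA by simp
  qed
  ultimately have eE: "(\<Sum>l\<in>L. card (abscissae P l) - 1) \<le> card E" by simp
  have "m * card L = (\<Sum>l\<in>L. m)" by simp
  also have "\<dots> \<le> (\<Sum>l\<in>L. card (abscissae P l) - 1)"
    by (intro sum_mono) (auto simp: L_def rich_lines_def)
  finally have mL: "m * card L \<le> card E" using eE by simp
  have "(\<Sum>l\<in>L. card (abscissae P l)) \<le> (\<Sum>l\<in>L. 2 * (card (abscissae P l) - 1))"
    using m by (intro sum_mono) (auto simp: L_def rich_lines_def)
  also have "\<dots> \<le> 2 * card E" using eE by (simp add: sum_distrib_left[symmetric])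
  finally have I: "(\<Sum>l\<in>L. card (abscissae P l)) \<le> 2 * card E" .
  \<comment> \<open>A crossing is determined by its two lines, since their only common point lies inside at most
    one edge of each.\<close>
  have "card (crossings E) \<le> card (L \<times> L)"
  proof (rule card_inj_on_le)
    show "inj_on (\<lambda>(e, f). (fst e, fst f)) (crossings E)"
    proof (rule inj_onI)
      fix p q assume c: "p \<in> crossings E" "q \<in> crossings E"
        and eq: "(\<lambda>(e, f). (fst e, fst f)) p = (\<lambda>(e, f). (fst e, fst f)) q"
      obtain l a b l' a' b' where p: "p = ((l, a, b), (l', a', b'))" by (metis surj_pair)
      obtain s t s' t' where q: "q = ((l, s, t), (l', s', t'))" using eq p by (cases q) auto
      have "crossing (l, a, b) (l', a', b')" "crossing (l, s, t) (l', s', t')"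
        using c by (auto simp: crossings_def p q)
      then obtain x y where x: "a < x" "a' < x" "x < b" "x < b'" "height l x = height l' x"
        and y: "s < y" "s' < y" "y < t" "y < t'" "height l y = height l' y"
        and ne: "(l, a, b) \<noteq> (l', a', b')"
        unfolding crossing_def by auto
      have E: "(l, a, b) \<in> E" "(l', a', b') \<in> E" "(l, s, t) \<in> E" "(l', s', t') \<in> E"
        using c by (auto simp: crossings_def p q)
      have uniq: "a = s \<and> b = t"
        if "(l, a, b) \<in> E" "(l, s, t) \<in> E" "a < x" "s < x" "x < b" "x < t"
        for l a b s t x
        using that unfolding E_def by (smt (verit) case_prodD mem_Collect_eq)
      have "l \<noteq> l'" using uniq[of l a b a' b' x] E x ne by auto
      then have "x = y" using lines_eqI[of l x l' y] x y by auto
      then show "p = q"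
        using uniq[of l a b s t x] uniq[of l' a' b' s' t' x] x y E by (auto simp: p q)
    qed
    show "(\<lambda>(e, f). (fst e, fst f)) ` crossings E \<subseteq> L \<times> L"
      by (auto simp: crossings_def E_def)
  qed (use L in auto)
  then have X: "card (crossings E) \<le> card L ^ 2"
    by (simp add: card_cartesian_product power2_eq_square)
  have "real (card E) \<le> 256 * real (card P) ^ 2 / real m ^ 2 + 4 * card P"
  proof (cases "4 * card P \<le> card E \<and> card E > 0")
    case False
    then have "real (card E) \<le> real (4 * card P)" by (intro of_nat_mono) linarith
    then show ?thesis by (smt (verit) divide_nonneg_nonneg of_nat_0_le_iff of_nat_mult of_nat_numeral zero_le_power mult_nonneg_nonneg)
  next
    case True
    define e where "e = real (card E)"
    have e: "e > 0" using True by (simp add: e_def)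
    have "e ^ 3 * real m ^ 2 \<le> 256 * real (card P) ^ 2 * card (crossings E) * real m ^ 2"
      unfolding e_def using crossing_lemma True by (intro mult_right_mono) auto
    also have "\<dots> \<le> 256 * real (card P) ^ 2 * real (card L ^ 2) * real m ^ 2"
      using X by (intro mult_right_mono mult_left_mono of_nat_mono) auto
    also have "\<dots> = 256 * real (card P) ^ 2 * (real (m * card L)) ^ 2"
      by (simp add: power_mult_distrib)
    also have "\<dots> \<le> 256 * real (card P) ^ 2 * e ^ 2"
      unfolding e_def using mL by (intro mult_left_mono power_mono of_nat_mono) auto
    finally have "e ^ 2 * (e * real m ^ 2) \<le> e ^ 2 * (256 * real (card P) ^ 2)"
      by (simp add: power3_eq_cube power2_eq_square algebra_simps)
    then have "e * real m ^ 2 \<le> 256 * real (card P) ^ 2" using e by simp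
    then have "e \<le> 256 * real (card P) ^ 2 / real m ^ 2" using m by (simp add: pos_le_divide_eq)
    then show ?thesis by (simp add: e_def)
  qed
  moreover have "real (\<Sum>l\<in>L. card (abscissae P l)) \<le> real (2 * card E)" using I
    by (intro of_nat_mono)
  ultimately show ?thesis unfolding L_def by simp
qed

section \<open>Determinants and projection along a vector\<close>

definition det_tuples :: "nat \<Rightarrow> real \<Rightarrow> real vec set \<Rightarrow> real vec list set" where
  "det_tuples d c S = {vs. set vs \<subseteq> S \<and> length vs = d \<and> det (mat_of_cols d vs) = c}"

lemma finite_det_tuples: "finite S \<Longrightarrow> finite (det_tuples d c S)"
  by (rule finite_subset[OF _ finite_lists_length_eq[of S d]]) (auto simp: det_tuples_def)

text \<open>
  Scaling the first column. It shows that the determinant and the remaining columns determine a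
  first column of known direction.
\<close>
lemma det_smult_first:
  assumes "u \<in> carrier_vec (Suc D)" "length ws = D"
  shows "det (mat_of_cols (Suc D) ((a \<cdot>\<^sub>v u) # ws)) = a * det (mat_of_cols (Suc D) (u # ws))"
proof -
  let ?A = "mat_of_cols (Suc D) (u # ws)" and ?A' = "mat_of_cols (Suc D) ((a \<cdot>\<^sub>v u) # ws)"
  have A: "?A \<in> carrier_mat (Suc D) (Suc D)" "?A' \<in> carrier_mat (Suc D) (Suc D)"
    using assms mat_of_cols_carrier(1)[of "Suc D" "_ # ws"] by auto
  have "mat_delete ?A' i 0 = mat_delete ?A i 0" for i
    by (rule eq_matI) (auto simp: mat_delete_def mat_of_cols_def assms)
  then have "cofactor ?A' i 0 = cofactor ?A i 0" for i by (simp add: cofactor_def)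
  then show ?thesis
    unfolding laplace_expansion_column[OF A(1) zero_less_Suc] laplace_expansion_column[OF A(2) zero_less_Suc]
    using assms by (simp add: sum_distrib_left mat_of_cols_Cons_index_0 mult.assoc del: sum.lessThan_Suc)
qed

text \<open>
  The linear projection along \<open>u\<close> onto the hyperplane on which coordinate \<open>i\<close> vanishes, followed
  by deleting that coordinate.
\<close>
definition proj :: "nat \<Rightarrow> real vec \<Rightarrow> real vec \<Rightarrow> real vec" where
  "proj i u x = vec (dim_vec u - 1)
     (\<lambda>r. let r' = (if r < i then r else Suc r) in x $ r' - x $ i / u $ i * u $ r')"

lemma proj_carrier: "u \<in> carrier_vec (Suc D) \<Longrightarrow> proj i u x \<in> carrier_vec D"
  by (rule carrier_vecI) (simp add: proj_def)

lemma proj_eqD: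
  assumes u: "u \<in> carrier_vec (Suc D)" "i < Suc D" "u $ i \<noteq> 0"
    and xy: "x \<in> carrier_vec (Suc D)" "y \<in> carrier_vec (Suc D)" "proj i u x = proj i u y"
  shows "\<exists>a. y = x + a \<cdot>\<^sub>v u"
proof (intro exI eq_vecI)
  let ?a = "(y $ i - x $ i) / u $ i"
  fix k assume "k < dim_vec (x + ?a \<cdot>\<^sub>v u)"
  then have k: "k < Suc D" using u by simp
  have "y $ k - x $ k = ?a * u $ k"
  proof (cases "k = i")
    case True
    then show ?thesis using u by simp
  next
    case False
    define r where "r = (if k < i then k else k - 1)"
    have r: "r < D" "(if r < i then r else Suc r) = k" using False k u by (auto simp: r_def)
    have "proj i u x $ r = proj i u y $ r" using xy by simp
    then show ?thesis using r u by (simp add: proj_def Let_def field_simps)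
  qed
  then show "y $ k = (x + ?a \<cdot>\<^sub>v u) $ k" using k u by simp
qed (use assms in auto)

text \<open>
  Subtracting multiples of the column \<open>u\<close> from the others makes their entries in row \<open>i\<close>
  vanish; the determinant is then expanded along this row.
\<close>
lemma det_proj:
  assumes u: "u \<in> carrier_vec (Suc D)" and i: "i < Suc D" "u $ i \<noteq> 0"
    and ws: "set ws \<subseteq> carrier_vec (Suc D)" "length ws = D"
  shows "det (mat_of_cols (Suc D) (u # ws)) = (-1) ^ i * u $ i * det (mat_of_cols D (map (proj i u) ws))"
proof -
  let ?A = "mat_of_cols (Suc D) (u # ws)"
  \<comment> \<open>Multiplication by \<open>B\<close> performs the column operations.\<close>
  define B where "B = mat (Suc D) (Suc D)
     (\<lambda>(k, j). if k = j then 1 else if k = 0 then - (ws ! (j - 1) $ i / u $ i) else (0 :: real))"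
  have A: "?A \<in> carrier_mat (Suc D) (Suc D)"
    using ws mat_of_cols_carrier(1)[of "Suc D" "u # ws"] by simp
  have B: "B \<in> carrier_mat (Suc D) (Suc D)" by (simp add: B_def)
  have "upper_triangular B" by (auto simp: upper_triangular_def B_def)
  then have "det B = prod_list (diag_mat B)" using det_upper_triangular B by blast
  also have "\<dots> = (\<Prod>k\<in>{0..<Suc D}. B $$ (k, k))" using B
    by (simp add: prod_list_diag_prod)
  also have "\<dots> = 1" by (intro prod.neutral) (auto simp: B_def)
  finally have detB: "det B = 1" .
  define M where "M = ?A * B"
  have M: "M \<in> carrier_mat (Suc D) (Suc D)" using A B by (simp add: M_def)
  have Mij: "M $$ (r, j) = (\<Sum>k<Suc D. ?A $$ (r, k) * B $$ (k, j))"
    if "r < Suc D" "j < Suc D" for r j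
    unfolding M_def using that A B ws
    by (simp add: scalar_prod_def atLeast0LessThan del: sum.lessThan_Suc)
  have M0: "M $$ (r, 0) = u $ r" if "r < Suc D" for r
  proof -
    have "M $$ (r, 0) = (\<Sum>k<Suc D. ?A $$ (r, k) * B $$ (k, 0))"
      using that by (intro Mij) auto
    also have "\<dots> = (\<Sum>k<Suc D. if k = 0 then u $ r else 0)"
      using that by (intro sum.cong) (auto simp: B_def mat_of_cols_Cons_index_0)
    finally show ?thesis by simp
  qed
  have MS: "M $$ (r, Suc j) = ws ! j $ r - ws ! j $ i / u $ i * u $ r"
    if "r < Suc D" "j < D" for r j
  proof -
    have "M $$ (r, Suc j) = (\<Sum>k<Suc D. ?A $$ (r, k) * B $$ (k, Suc j))"
      using that by (intro Mij) auto
    also have "\<dots> = ?A $$ (r, 0) * B $$ (0, Suc j) + (\<Sum>k<D. ?A $$ (r, Suc k) * B $$ (Suc k, Suc j))"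
      by (rule sum.lessThan_Suc_shift)
    also have "(\<Sum>k<D. ?A $$ (r, Suc k) * B $$ (Suc k, Suc j)) = (\<Sum>k<D. if k = j then ?A $$ (r, Suc j) else 0)"
      using that by (intro sum.cong) (auto simp: B_def)
    also have "\<dots> = ?A $$ (r, Suc j)" using that by simp
    also have "\<dots> = ws ! j $ r" using that ws by (simp add: mat_of_cols_def)
    also have "?A $$ (r, 0) * B $$ (0, Suc j) = - (ws ! j $ i / u $ i * u $ r)"
      using that by (simp add: B_def mat_of_cols_Cons_index_0)
    finally show ?thesis by simp
  qed
  have "det ?A = det M" using det_mult[OF A B] detB by (simp add: M_def)
  also have "\<dots> = (\<Sum>j<Suc D. M $$ (i, j) * cofactor M i j)"
    by (rule laplace_expansion_row[OF M i(1)])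
  also have "\<dots> = u $ i * cofactor M i 0"
    using i M0 MS by (simp add: sum.lessThan_Suc_shift del: sum.lessThan_Suc)
  also have "mat_delete M i 0 = mat_of_cols D (map (proj i u) ws)"
  proof (rule eq_matI)
    fix r j assume "r < dim_row (mat_of_cols D (map (proj i u) ws))" "j < dim_col (mat_of_cols D (map (proj i u) ws))"
    then have rj: "r < D" "j < D" using ws by auto
    then show "mat_delete M i 0 $$ (r, j) = mat_of_cols D (map (proj i u) ws) $$ (r, j)"
      using M u ws i MS by (auto simp: mat_delete_def mat_of_cols_index proj_def Let_def)
  qed (use M ws in \<open>auto simp: mat_delete_def\<close>)
  then have "cofactor M i 0 = (-1) ^ i * det (mat_of_cols D (map (proj i u) ws))"
    by (simp add: cofactor_def)
  finally show ?thesis by simp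
qed

section \<open>Generic projection to the plane and heavy lists\<close>

text \<open>
  The functional with coefficients \<open>1, t, t^2, \<dots>\<close>. On a fixed nonzero vector it is a nonzero
  polynomial in \<open>t\<close>, so all but finitely many \<open>t\<close> avoid any finite set of kernels.
\<close>
definition moment :: "real \<Rightarrow> real vec \<Rightarrow> real" where
  "moment t v = (\<Sum>i<dim_vec v. v $ i * t ^ i)"

lemma moment_diff: "x \<in> carrier_vec d \<Longrightarrow> y \<in> carrier_vec d
  \<Longrightarrow> moment t (x - y) = moment t x - moment t y"
  by (simp add: moment_def sum_subtractf left_diff_distrib)

lemma moment_add: "x \<in> carrier_vec d \<Longrightarrow> y \<in> carrier_vec d
  \<Longrightarrow> moment t (x + y) = moment t x + moment t y"
  by (simp add: moment_def sum.distrib distrib_right)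

lemma moment_smult: "moment t (a \<cdot>\<^sub>v x) = a * moment t x"
  by (simp add: moment_def sum_distrib_left mult.assoc)

lemma moment_avoids:
  assumes "finite F" "\<And>v. v \<in> F \<Longrightarrow> v \<in> carrier_vec d \<and> v \<noteq> 0\<^sub>v d"
  shows "\<exists>t. \<forall>v\<in>F. moment t v \<noteq> 0"
proof -
  have "finite {t. moment t v = 0}" if "v \<in> F" for v
  proof -
    have v: "dim_vec v = d" "v \<noteq> 0\<^sub>v d" using assms(2) that by auto
    then obtain k where k: "k < d" "v $ k \<noteq> 0" by (auto simp: vec_eq_iff)
    have "finite {t. (\<Sum>i\<le>d. (if i < d then v $ i else 0) * t ^ i) = 0}"
      by (rule polyfun_rootbound[THEN conjunct1, of _ k]) (use k in auto)
    also have "{t. (\<Sum>i\<le>d. (if i < d then v $ i else 0) * t ^ i) = 0} = {t. moment t v = 0}"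
      by (simp add: moment_def v lessThan_Suc_atMost[symmetric])
    finally show ?thesis .
  qed
  then have "finite (\<Union>v\<in>F. {t. moment t v = 0})" using assms(1) by blast
  then obtain t where "t \<notin> (\<Union>v\<in>F. {t. moment t v = 0})"
    using ex_new_if_finite[OF infinite_UNIV_char_0] by blast
  then show ?thesis by auto
qed

text \<open>
  Choose \<open>t\<close> first, so that distinct points get distinct first coordinates. The images of
  \<open>x - z\<close> and \<open>y - z\<close> are parallel if and only if the second functional kills the vector
  \<open>w x y z\<close> below. This vector is fixed once \<open>t\<close> is, and it vanishes only if
  \<open>x - z\<close> is a multiple of \<open>y - z\<close>. So \<open>s\<close> only has to avoid finitely many nonzero vectors.
\<close>
lemma generic_plane_projection:
  assumes S: "finite S" "S \<subseteq> carrier_vec d"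
  obtains t s where "inj_on (moment t) S"
    "\<And>x y z. \<lbrakk>x \<in> S; y \<in> S; z \<in> S; y \<noteq> z;
        (moment t x - moment t z) * (moment s y - moment s z) = (moment t y - moment t z) * (moment s x - moment s z)\<rbrakk>
       \<Longrightarrow> \<exists>c. x - z = c \<cdot>\<^sub>v (y - z)"
proof -
  define F where "F = {x - y | x y. x \<in> S \<and> y \<in> S \<and> x \<noteq> y}"
  have "F = (\<lambda>(x, y). x - y) ` {p \<in> S \<times> S. fst p \<noteq> snd p}"
    by (force simp: F_def)
  then have "finite F" using S by simp
  moreover have "v \<in> carrier_vec d \<and> v \<noteq> 0\<^sub>v d" if vF: "v \<in> F" for v
  proof -
    obtain x y where v: "v = x - y" "x \<in> S" "y \<in> S" "x \<noteq> y" using vF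
      by (auto simp: F_def)
    then have c: "x \<in> carrier_vec d" "y \<in> carrier_vec d" using S by auto
    have "x = y" if "x - y = 0\<^sub>v d"
    proof (rule eq_vecI)
      fix k assume "k < dim_vec y"
      then have "(x - y) $ k = x $ k - y $ k" "(0\<^sub>v d :: real vec) $ k = 0" using c by auto
      then show "x $ k = y $ k" using that by simp
    qed (use c in auto)
    then show ?thesis using v c by auto
  qed
  ultimately obtain t where t: "\<forall>v\<in>F. moment t v \<noteq> 0" using moment_avoids[of F d]
    by auto
  have tne: "moment t x \<noteq> moment t y" if "x \<in> S" "y \<in> S" "x \<noteq> y" for x y
  proof -
    have "moment t (x - y) \<noteq> 0" using t that unfolding F_def by blast
    moreover have "moment t (x - y) = moment t x - moment t y" using that S
      by (intro moment_diff[of _ d]) auto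
    ultimately show ?thesis by simp
  qed
  define w where "w x y z = moment t (x - z) \<cdot>\<^sub>v (y - z) - moment t (y - z) \<cdot>\<^sub>v (x - z)" for x y z
  define G where "G = {w x y z | x y z. x \<in> S \<and> y \<in> S \<and> z \<in> S} - {0\<^sub>v d}"
  have "{w x y z | x y z. x \<in> S \<and> y \<in> S \<and> z \<in> S} = (\<lambda>(x, y, z). w x y z) ` (S \<times> S \<times> S)"
    by (auto simp: image_iff) blast
  then have "finite G" using S by (simp add: G_def)
  moreover have "v \<in> carrier_vec d \<and> v \<noteq> 0\<^sub>v d" if vG: "v \<in> G" for v
  proof -
    obtain x y z where v: "v = w x y z" "x \<in> S" "y \<in> S" "z \<in> S" "v \<noteq> 0\<^sub>v d"
      using vG by (auto simp: G_def)
    then have "x \<in> carrier_vec d" "y \<in> carrier_vec d" "z \<in> carrier_vec d" using S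
      by auto
    then show ?thesis using v by (simp add: w_def)
  qed
  ultimately obtain s where s: "\<forall>v\<in>G. moment s v \<noteq> 0" using moment_avoids[of G d]
    by auto
  show thesis
  proof (rule that)
    show "inj_on (moment t) S" using tne by (auto simp: inj_on_def)
    fix x y z
    assume xyz: "x \<in> S" "y \<in> S" "z \<in> S" "y \<noteq> z"
      and eq: "(moment t x - moment t z) * (moment s y - moment s z) = (moment t y - moment t z) * (moment s x - moment s z)"
    have c: "x \<in> carrier_vec d" "y \<in> carrier_vec d" "z \<in> carrier_vec d" using S xyz
      by auto
    have "moment s (w x y z) = moment t (x - z) * moment s (y - z) - moment t (y - z) * moment s (x - z)"
      unfolding w_def by (subst moment_diff[of _ d]) (use c in \<open>auto simp: moment_smult\<close>)
    also have "\<dots> = 0" using eq c by (simp add: moment_diff[of _ d])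
    finally have "w x y z \<notin> G" using s by auto
    then have w0: "w x y z = 0\<^sub>v d" using xyz by (auto simp: G_def)
    have ne: "moment t (y - z) \<noteq> 0" using tne[of y z] xyz c
      by (simp add: moment_diff[of _ d])
    show "\<exists>c. x - z = c \<cdot>\<^sub>v (y - z)"
    proof (intro exI eq_vecI)
      let ?c = "moment t (x - z) / moment t (y - z)"
      fix k assume "k < dim_vec (?c \<cdot>\<^sub>v (y - z))"
      then have k: "k < d" using c by simp
      have "w x y z $ k = 0" using w0 k by simp
      then show "(x - z) $ k = (?c \<cdot>\<^sub>v (y - z)) $ k" using k c ne
        by (simp add: w_def field_simps)
    qed (use c in auto)
  qed
qed

definition parallels :: "real vec set \<Rightarrow> real vec \<Rightarrow> real vec \<Rightarrow> real vec set" where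
  "parallels S u x = {y \<in> S. \<exists>a. y = x + a \<cdot>\<^sub>v u}"

text \<open>
  A heavy list \<open>u # ws\<close> is encoded by the image in the plane of the line through \<open>ws ! i\<close> in
  direction \<open>u\<close>, by the point \<open>ws ! i\<close> on it, and by the other entries of \<open>ws\<close>. The line in the
  plane contains the images of two points of \<open>S\<close> whose difference is parallel to \<open>u\<close>, and the
  projection preserves non-collinearity. So the code yields the direction of \<open>u\<close>; the
  determinant \<open>c \<noteq> 0\<close> yields its length.
\<close>
lemma count_heavy_tuples:
  assumes S: "finite S" "S \<subseteq> carrier_vec (Suc D)" and m: "m \<ge> 1" and c: "c \<noteq> 0"
    and i: "i < D"
  shows "real (card {vs \<in> det_tuples (Suc D) c S. m < card (parallels S (hd vs) (tl vs ! i))})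
    \<le> (512 * real (card S) ^ 2 / real m ^ 2 + 8 * card S) * real (card S) ^ (D - 1)"
proof -
  obtain t s where inj: "inj_on (moment t) S"
    and coll: "\<And>x y z. \<lbrakk>x \<in> S; y \<in> S; z \<in> S; y \<noteq> z;
        (moment t x - moment t z) * (moment s y - moment s z) = (moment t y - moment t z) * (moment s x - moment s z)\<rbrakk>
       \<Longrightarrow> \<exists>c. x - z = c \<cdot>\<^sub>v (y - z)"
    using generic_plane_projection[OF S] by metis
  define P where "P = (\<lambda>x. (moment t x, moment s x)) ` S"
  define H where "H = {vs \<in> det_tuples (Suc D) c S. m < card (parallels S (hd vs) (tl vs ! i))}"
  \<comment> \<open>\<open>l u x\<close> is the image in the plane of the line \<open>x + R u\<close>.\<close>
  define sl where "sl u = moment s u / moment t u" for u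
  define l where "l u x = (sl u, moment s x - sl u * moment t x)" for u x
  define R where "R = rich_lines P m"
  define W where "W = {ws. set ws \<subseteq> S \<and> length ws = D - 1}"
  have P: "finite P" "card P \<le> card S" using S by (auto simp: P_def card_image_le)
  have R: "finite R" unfolding R_def using finite_rich_lines[OF P(1) m] .
  have W: "finite W" "card W = card S ^ (D - 1)"
    unfolding W_def using S finite_lists_length_eq card_lists_length_eq by auto
  have key: "\<exists>y\<in>S. \<exists>a. y \<noteq> x \<and> a \<noteq> 0 \<and> y = x + a \<cdot>\<^sub>v u \<and> moment t u \<noteq> 0
      \<and> l u x \<in> R \<and> moment t x \<in> abscissae P (l u x)"
    if u: "u \<in> S" and x: "x \<in> S" and big: "m < card (parallels S u x)" for u x
  proof -
    have cu: "u \<in> carrier_vec (Suc D)" "x \<in> carrier_vec (Suc D)" using S u x by auto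
    have xp: "x \<in> parallels S u x" using x cu unfolding parallels_def
      by (auto intro!: exI[of _ 0])
    have fp: "finite (parallels S u x)" using S by (simp add: parallels_def)
    have "\<not> parallels S u x \<subseteq> {x}"
      using big m card_mono[of "{x}" "parallels S u x"] by auto
    then obtain y where y: "y \<in> parallels S u x" "y \<noteq> x" by auto
    then obtain a where a: "y = x + a \<cdot>\<^sub>v u" "y \<in> S" by (auto simp: parallels_def)
    have a0: "a \<noteq> 0" using a y cu by auto
    have mt: "moment r (x + b \<cdot>\<^sub>v u) = moment r x + b * moment r u" for r b
      using moment_add[of x "Suc D" "b \<cdot>\<^sub>v u" r] cu by (simp add: moment_smult)
    have "moment t y \<noteq> moment t x" using inj a x y by (auto simp: inj_on_def)
    then have tu: "moment t u \<noteq> 0" using mt a by auto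
    have h: "(moment t z, height (l u x) (moment t z)) \<in> P"
      if z: "z \<in> parallels S u x" for z
    proof -
      obtain b where b: "z = x + b \<cdot>\<^sub>v u" "z \<in> S" using z
        by (auto simp: parallels_def)
      have "height (l u x) (moment t z) = moment s z"
        using tu unfolding b(1) mt height_def l_def sl_def by (simp add: field_simps)
      then show ?thesis using b by (simp add: P_def)
    qed
    have "card (parallels S u x) = card (moment t ` parallels S u x)"
      using inj by (intro card_image[symmetric] inj_on_subset[OF inj]) (auto simp: parallels_def)
    also have "\<dots> \<le> card (abscissae P (l u x))"
      using h by (intro card_mono finite_abscissae P) (auto simp: abscissae_def)
    finally have "l u x \<in> R" using big by (simp add: R_def rich_lines_def)
    then show ?thesis using y a a0 tu h[OF xp] by (auto simp: abscissae_def)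
  qed
  have Hform: "\<exists>u ws. vs = u # ws \<and> u \<in> S \<and> set ws \<subseteq> S \<and> length ws = D \<and> ws ! i \<in> S \<and>
      m < card (parallels S u (ws ! i)) \<and> det (mat_of_cols (Suc D) (u # ws)) = c" if "vs \<in> H" for vs
    using that i by (cases vs) (auto simp: H_def det_tuples_def subset_iff)
  define f where "f vs = ((l (hd vs) (tl vs ! i), moment t (tl vs ! i)), take i (tl vs) @ drop (Suc i) (tl vs))" for vs
  have "card H \<le> card ((SIGMA l:R. abscissae P l) \<times> W)"
  proof (rule card_inj_on_le)
    show "f ` H \<subseteq> (SIGMA l:R. abscissae P l) \<times> W"
    proof (rule image_subsetI)
      fix vs assume "vs \<in> H"
      then obtain u ws where v: "vs = u # ws" "u \<in> S" "set ws \<subseteq> S" "length ws = D" "ws ! i \<in> S"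
        "m < card (parallels S u (ws ! i))" using Hform by blast
      show "f vs \<in> (SIGMA l:R. abscissae P l) \<times> W"
        using key[OF v(2,5,6)] v i set_take_subset[of i ws] set_drop_subset[of "Suc i" ws]
        by (auto simp: f_def W_def)
    qed
    show "inj_on f H"
    proof (rule inj_onI)
      fix vs vs' assume "vs \<in> H" "vs' \<in> H" and f: "f vs = f vs'"
      then obtain u ws u' ws' where v: "vs = u # ws" "u \<in> S" "set ws \<subseteq> S" "length ws = D" "ws ! i \<in> S"
        "m < card (parallels S u (ws ! i))" "det (mat_of_cols (Suc D) (u # ws)) = c"
       and v': "vs' = u' # ws'" "u' \<in> S" "set ws' \<subseteq> S" "length ws' = D" "ws' ! i \<in> S"
        "m < card (parallels S u' (ws' ! i))" "det (mat_of_cols (Suc D) (u' # ws')) = c" using Hform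
          by meson
      have x: "ws ! i = ws' ! i" using f v v' inj by (auto simp: f_def inj_on_def)
      have "take i ws = take i ws'" "drop (Suc i) ws = drop (Suc i) ws'"
        using f v v' by (auto simp: f_def)
      then have ws: "ws = ws'" using x i v(4) v'(4) id_take_nth_drop[of i ws] id_take_nth_drop[of i ws'] by simp
      obtain y a where y: "y \<in> S" "y \<noteq> ws ! i" "a \<noteq> 0" "y = ws ! i + a \<cdot>\<^sub>v u" "moment t u \<noteq> 0"
        using key[OF v(2,5,6)] by auto
      obtain y' a' where y': "y' \<in> S" "y' \<noteq> ws ! i" "a' \<noteq> 0" "y' = ws ! i + a' \<cdot>\<^sub>v u'" "moment t u' \<noteq> 0"
        using key[OF v'(2,5,6)] x by auto
      have cv: "u \<in> carrier_vec (Suc D)" "u' \<in> carrier_vec (Suc D)" "ws ! i \<in> carrier_vec (Suc D)"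
        using S v v' by auto
      have yd: "y - ws ! i = a \<cdot>\<^sub>v u" "y' - ws ! i = a' \<cdot>\<^sub>v u'" using cv
        unfolding y(4) y'(4) by auto
      have mom: "moment r y - moment r (ws ! i) = a * moment r u" "moment r y' - moment r (ws ! i) = a' * moment r u'" for r
        using moment_diff[of y "Suc D" "ws ! i" r] moment_diff[of y' "Suc D" "ws ! i" r] yd cv y y' S
        by (auto simp: moment_smult)
      have "sl u = sl u'" using f v v' by (simp add: f_def l_def)
      then have "moment s u * moment t u' = moment s u' * moment t u" using y y'
        by (simp add: sl_def field_simps)
      then have "(moment t y' - moment t (ws ! i)) * (moment s y - moment s (ws ! i))
          = (moment t y - moment t (ws ! i)) * (moment s y' - moment s (ws ! i))"
        unfolding mom by (simp add: mult_ac)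
      then obtain b where "y' - ws ! i = b \<cdot>\<^sub>v (y - ws ! i)"
        using coll[OF y'(1) y(1) v(5) y(2)] by blast
      then have e: "a' \<cdot>\<^sub>v u' = (b * a) \<cdot>\<^sub>v u" unfolding yd
        by (simp add: smult_smult_assoc)
      have "u' = (1 / a') \<cdot>\<^sub>v (a' \<cdot>\<^sub>v u')" using y'(3)
        by (simp add: smult_smult_assoc)
      also have "\<dots> = (b * a / a') \<cdot>\<^sub>v u" unfolding e
        by (simp add: smult_smult_assoc)
      finally have u': "u' = (b * a / a') \<cdot>\<^sub>v u" .
      have "c = (b * a / a') * c"
        using v(7) v'(7) ws det_smult_first[OF cv(1) v(4), of "b * a / a'"] u' by metis
      then have "b * a / a' = 1" using c by (metis mult_cancel_right1)
      then have "u' = u" unfolding u' by (simp only: one_smult_vec)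
      then show "vs = vs'" using v v' ws by simp
    qed
  qed (use R W P in \<open>auto intro: finite_abscissae\<close>)
  also have "\<dots> = (\<Sum>l\<in>R. card (abscissae P l)) * card S ^ (D - 1)"
    using R P W finite_abscissae by (simp add: card_cartesian_product)
  finally have "real (card H) \<le> real ((\<Sum>l\<in>R. card (abscissae P l)) * card S ^ (D - 1))"
    by (rule of_nat_mono)
  also have "\<dots> = real (\<Sum>l\<in>R. card (abscissae P l)) * real (card S) ^ (D - 1)" by simp
  also have "\<dots> \<le> (512 * real (card P) ^ 2 / real m ^ 2 + 8 * card P) * real (card S) ^ (D - 1)"
    unfolding R_def using rich_lines_incidences[OF P(1) m] by (intro mult_right_mono) auto
  also have "\<dots> \<le> (512 * real (card S) ^ 2 / real m ^ 2 + 8 * card S) * real (card S) ^ (D - 1)"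
    using P(2) by (intro mult_right_mono add_mono divide_right_mono mult_left_mono power_mono) auto
  finally show ?thesis unfolding H_def .
qed

section \<open>Light lists\<close>

text \<open>
  Sort \<open>I\<close> by the value of \<open>f\<close> and colour the positions cyclically with \<open>m\<close> colours. A fibre
  occupies at most \<open>m\<close> consecutive positions, so its elements get distinct colours.
\<close>
lemma equitable_colouring:
  assumes I: "finite I" and m: "m \<ge> 1"
    and fib: "\<And>x. x \<in> I \<Longrightarrow> card {y \<in> I. f y = f x} \<le> m"
  obtains col :: "'a \<Rightarrow> nat" where "\<And>x. x \<in> I \<Longrightarrow> col x < m"
    "\<And>k. inj_on f {x \<in> I. col x = k}" "\<And>k. card {x \<in> I. col x = k} \<le> card I div m + 1"
proof -
  obtain r :: "_ \<Rightarrow> nat" and N where r: "inj_on r (f ` I)"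
    using finite_imp_inj_to_nat_seg[of "f ` I"] I by auto
  obtain xs where xs: "set xs = I" "distinct xs" using finite_distinct_list[OF I] by auto
  define ys where "ys = sort_key (\<lambda>x. r (f x)) xs"
  have ys: "set ys = I" "distinct ys" "sorted (map (\<lambda>x. r (f x)) ys)" using xs
    by (auto simp: ys_def)
  have len: "length ys = card I" using ys distinct_card by metis
  define g where "g x = (SOME p. p < length ys \<and> ys ! p = x)" for x
  have g: "g x < length ys \<and> ys ! g x = x" if "x \<in> I" for x
    unfolding g_def by (rule someI_ex) (use that ys in \<open>metis in_set_conv_nth\<close>)
  \<comment> \<open>Two elements of a fibre enclose only elements of that fibre.\<close>
  have close: "g y < g x + m" if x: "x \<in> I" and y: "y \<in> I"
    and xy: "f x = f y" "g x \<le> g y" for x y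
  proof (rule ccontr)
    assume "\<not> ?thesis"
    then have far: "g x + m \<le> g y" by simp
    have "ys ! p \<in> {z \<in> I. f z = f x}" if p: "p \<in> {g x..g x + m}" for p
    proof -
      have p': "g x \<le> p" "p \<le> g y" "p < length ys" using p far g[OF y] by auto
      have "r (f (ys ! g x)) \<le> r (f (ys ! p))" "r (f (ys ! p)) \<le> r (f (ys ! g y))"
        using sorted_nth_mono[OF ys(3), of "g x" p] sorted_nth_mono[OF ys(3), of p "g y"] p' g[OF y]
        by auto
      then have "r (f (ys ! p)) = r (f x)" using g[OF x] g[OF y] xy by simp
      moreover have "ys ! p \<in> I" using p' ys by auto
      ultimately show ?thesis using r x by (auto simp: inj_on_def)
    qed
    then have "card {g x..g x + m} \<le> card {z \<in> I. f z = f x}"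
      using far g[OF y] ys(2) I
      by (intro card_inj_on_le[of "\<lambda>p. ys ! p"]) (auto simp: inj_on_def nth_eq_iff_index_eq)
    then show False using fib[OF x] by simp
  qed
  show thesis
  proof (rule that[of "\<lambda>x. g x mod m"])
    show "g x mod m < m" if "x \<in> I" for x using m by simp
    show "inj_on f {x \<in> I. g x mod m = k}" for k
    proof (rule inj_onI)
      fix x y assume xy: "x \<in> {x \<in> I. g x mod m = k}" "y \<in> {x \<in> I. g x mod m = k}" "f x = f y"
      have "g x = g y" if "x \<in> I" "y \<in> I" "f x = f y" "g x mod m = g y mod m" "g x \<le> g y" for x y
      proof -
        have "m dvd g y - g x" using that by (metis mod_eq_dvd_iff_nat)
        moreover have "g y - g x < m" using close[OF that(1,2,3,5)] that(5) by simp
        ultimately show ?thesis using that(5)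
          by (metis diff_is_0_eq dvd_imp_le le_antisym less_le_not_le not_gr_zero)
      qed
      then have "g x = g y" using xy by (metis (mono_tags, lifting) mem_Collect_eq nat_le_linear)
      then show "x = y" using g xy by (metis (mono_tags, lifting) mem_Collect_eq)
    qed
    show "card {x \<in> I. g x mod m = k} \<le> card I div m + 1" for k
    proof -
      have "card {x \<in> I. g x mod m = k} \<le> card {..card I div m}"
      proof (rule card_inj_on_le[of "\<lambda>x. g x div m"])
        show "inj_on (\<lambda>x. g x div m) {x \<in> I. g x mod m = k}"
        proof (rule inj_onI)
          fix x y assume xy: "x \<in> {x \<in> I. g x mod m = k}" "y \<in> {x \<in> I. g x mod m = k}" "g x div m = g y div m"
          then have "g x = g y" by (metis (mono_tags, lifting) div_mult_mod_eq mem_Collect_eq)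
          then show "x = y" using g xy by (metis (mono_tags, lifting) mem_Collect_eq)
        qed
        show "(\<lambda>x. g x div m) ` {x \<in> I. g x mod m = k} \<subseteq> {..card I div m}"
        proof (rule image_subsetI)
          fix x assume "x \<in> {x \<in> I. g x mod m = k}"
          then have "g x \<le> card I" using g[of x] len by simp
          then show "g x div m \<in> {..card I div m}" by (simp add: div_le_mono)
        qed
      qed simp
      then show ?thesis by simp
    qed
  qed
qed

text \<open>
  A list is encoded by its colours together with its image under the projection along \<open>u\<close>. For
  fixed colours the image is a list over the at most \<open>D * (card I / m + 1)\<close> projections of the points
  that have one of these colours, and its determinant is fixed. The bound for dimension \<open>D\<close>
  applies to it.
\<close>
lemma count_light_tuples:
  assumes IH: "\<And>c T. \<lbrakk>c \<noteq> 0; finite T; T \<subseteq> carrier_vec D\<rbrakk>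
    \<Longrightarrow> real (card (det_tuples D c T)) \<le> C * real (card T) powr e"
    and Ce: "C > 0" "e \<ge> 0"
    and I: "finite I" "I \<subseteq> carrier_vec (Suc D)" and u: "u \<in> carrier_vec (Suc D)"
    and m: "m \<ge> 1" and c: "c \<noteq> 0"
    and fib: "\<And>x. x \<in> I \<Longrightarrow> card (parallels I u x) \<le> m"
  shows "real (card {ws. set ws \<subseteq> I \<and> length ws = D \<and> det (mat_of_cols (Suc D) (u # ws)) = c})
           \<le> real m ^ D * (C * (real D * (real (card I) / real m + 1)) powr e)" (is "real (card ?L) \<le> _")
proof (cases "?L = {}")
  case True
  show ?thesis unfolding True using Ce by simp
next
  case False
  \<comment> \<open>For \<open>u = 0\<close> the determinant would vanish.\<close>
  have "\<exists>i<Suc D. u $ i \<noteq> 0"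
  proof (rule ccontr)
    assume "\<not> ?thesis"
    then have "u = 0 \<cdot>\<^sub>v u" using u by (intro eq_vecI) auto
    then have "det (mat_of_cols (Suc D) (u # ws)) = 0" if "length ws = D" for ws
      using det_smult_first[OF u that, of 0] by simp
    then show False using False c by auto
  qed
  then obtain i where i: "i < Suc D" "u $ i \<noteq> 0" by auto
  define f where "f = proj i u"
  have fibre: "card {y \<in> I. f y = f x} \<le> m" if x: "x \<in> I" for x
  proof -
    have "{y \<in> I. f y = f x} \<subseteq> parallels I u x"
      using proj_eqD[OF u i] I x unfolding f_def parallels_def by (auto simp: subset_iff)
    then have "card {y \<in> I. f y = f x} \<le> card (parallels I u x)"
      using I by (intro card_mono) (auto simp: parallels_def)
    then show ?thesis using fib[OF x] by simp
  qed
  obtain col where col: "\<And>x. x \<in> I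
    \<Longrightarrow> col x < m" "\<And>k. inj_on f {x \<in> I. col x = k}"
      "\<And>k. card {x \<in> I. col x = k} \<le> card I div m + 1"
    by (rule equitable_colouring[where f = f, OF I(1) m fibre]) blast+
  define T where "T ks = (\<Union>k\<in>set ks. f ` {x \<in> I. col x = k})" for ks
  define K where "K = {ks. set ks \<subseteq> {..<m} \<and> length ks = D}"
  define c' where "c' = c / ((-1) ^ i * u $ i)"
  have c': "c' \<noteq> 0" using c i by (simp add: c'_def)
  have K: "finite K" "card K = m ^ D"
    unfolding K_def using finite_lists_length_eq[of "{..<m}"] card_lists_length_eq[of "{..<m}"]
    by auto
  have fT: "finite (T ks)" "T ks \<subseteq> carrier_vec D" for ks
    using I u proj_carrier by (auto simp: T_def f_def)
  have cT: "card (T ks) \<le> D * (card I div m + 1)" if ks: "ks \<in> K" for ks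
  proof -
    have "card (T ks) \<le> (\<Sum>k\<in>set ks. card (f ` {x \<in> I. col x = k}))"
      unfolding T_def by (rule card_UN_le) simp
    also have "\<dots> \<le> (\<Sum>k\<in>set ks. card I div m + 1)"
      using I by (intro sum_mono order_trans[OF card_image_le col(3)]) auto
    also have "\<dots> \<le> D * (card I div m + 1)"
    proof -
      have "card (set ks) \<le> D" using ks card_length[of ks] by (simp add: K_def)
      then show ?thesis unfolding sum_constant of_nat_id by (rule mult_le_mono1)
    qed
    finally show ?thesis .
  qed
  have "card ?L \<le> card (SIGMA ks:K. det_tuples D c' (T ks))"
  proof (rule card_inj_on_le[of "\<lambda>ws. (map col ws, map f ws)"])
    show "inj_on (\<lambda>ws. (map col ws, map f ws)) ?L"
    proof (rule inj_onI)
      fix ws ws' assume *: "ws \<in> ?L" "ws' \<in> ?L" "(map col ws, map f ws) = (map col ws', map f ws')"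
      show "ws = ws'"
      proof (rule nth_equalityI)
        fix j assume j: "j < length ws"
        then have "ws ! j \<in> I" "ws' ! j \<in> I" using * by (auto simp: subset_iff)
        moreover have "map col ws ! j = map col ws' ! j" "map f ws ! j = map f ws' ! j" using *
          by auto
        then have "col (ws ! j) = col (ws' ! j)" "f (ws ! j) = f (ws' ! j)" using * j by auto
        ultimately show "ws ! j = ws' ! j" using col(2)[of "col (ws ! j)"]
          by (auto simp: inj_on_def)
      qed (use * in auto)
    qed
    show "(\<lambda>ws. (map col ws, map f ws)) ` ?L \<subseteq> (SIGMA ks:K. det_tuples D c' (T ks))"
    proof (rule image_subsetI)
      fix ws assume ws: "ws \<in> ?L"
      then have "set ws \<subseteq> carrier_vec (Suc D)" using I by auto
      then have "det (mat_of_cols D (map f ws)) = c'"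
        using det_proj[OF u i, of ws] ws i by (simp add: f_def c'_def)
      then show "(map col ws, map f ws) \<in> (SIGMA ks:K. det_tuples D c' (T ks))"
        using ws col(1) by (auto simp: K_def det_tuples_def T_def)
    qed
    show "finite (SIGMA ks:K. det_tuples D c' (T ks))"
      using K fT finite_det_tuples by blast
  qed
  also have "\<dots> = (\<Sum>ks\<in>K. card (det_tuples D c' (T ks)))" using K fT finite_det_tuples
    by simp
  finally have "real (card ?L) \<le> (\<Sum>ks\<in>K. real (card (det_tuples D c' (T ks))))"
    by (simp only: of_nat_sum[symmetric] of_nat_le_iff)
  also have "\<dots> \<le> (\<Sum>ks\<in>K. C * (real D * (real (card I) / real m + 1)) powr e)"
  proof (rule sum_mono)
    fix ks assume ks: "ks \<in> K"
    have "real (card (T ks)) \<le> real (D * (card I div m + 1))" using cT[OF ks]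
      by (rule of_nat_mono)
    also have "\<dots> \<le> real D * (real (card I) / real m + 1)"
    proof -
      have "real (card I div m + 1) \<le> real (card I) / real m + 1"
        using of_nat_div_le_of_nat[of "card I" m, where ?'a = real] by simp
      then show ?thesis unfolding of_nat_mult by (rule mult_left_mono) simp
    qed
    finally have "real (card (T ks)) powr e \<le> (real D * (real (card I) / real m + 1)) powr e"
      using Ce by (intro powr_mono2) auto
    then have "C * real (card (T ks)) powr e \<le> C * (real D * (real (card I) / real m + 1)) powr e"
      using Ce by (intro mult_left_mono) auto
    with IH[OF c' fT, of ks]
    show "real (card (det_tuples D c' (T ks))) \<le> C * (real D * (real (card I) / real m + 1)) powr e"
      by (rule order_trans)
  qed
  also have "\<dots> = real m ^ D * (C * (real D * (real (card I) / real m + 1)) powr e)"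
    using K by simp
  finally show ?thesis .
qed

section \<open>The induction on the dimension\<close>

text \<open>
  The heavy lists contribute \<open>n^d / m^2\<close>, and the light ones
  \<open>n * m^D * (n/m)^(D - 2/(D+1))\<close> with \<open>D = d - 1\<close>. Both are \<open>n^(d - 2/(d+1))\<close> when
  \<open>m = n^(1/(d+1))\<close>. In dimension \<open>1\<close> the exponent is \<open>0\<close>, and the only list consists of the
  number \<open>c\<close>.
\<close>
theorem count_det_tuples:
  assumes "d \<ge> 1"
  shows "\<exists>C>0. \<forall>c S. c \<noteq> 0 \<longrightarrow> finite S
    \<longrightarrow> S \<subseteq> carrier_vec d \<longrightarrow>
           real (card (det_tuples d c S)) \<le> C * real (card S) powr (real d - 2 / (real d + 1))"
  using assms
proof (induction d rule: dec_induct)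
  case base
  have "real (card (det_tuples 1 c S)) \<le> 1 * real (card S) powr (real 1 - 2 / (real 1 + 1))"
    if S: "finite S" "S \<subseteq> carrier_vec 1" for c S
  proof (cases "S = {}")
    case True
    then show ?thesis by (simp add: det_tuples_def card_eq_0_iff)
  next
    case False
    have "det_tuples 1 c S \<subseteq> {[vec 1 (\<lambda>_. c)]}"
    proof
      fix vs assume "vs \<in> det_tuples 1 c S"
      then obtain v where v: "vs = [v]" "v \<in> carrier_vec 1" "det (mat_of_cols 1 [v]) = c"
        using S by (auto simp: det_tuples_def length_Suc_conv)
      have "det (mat_of_cols 1 [v]) = v $ 0"
        by (subst det_single) (auto simp: mat_of_cols_def)
      then have "v = vec 1 (\<lambda>_. c)" using v by (intro eq_vecI) auto
      then show "vs \<in> {[vec 1 (\<lambda>_. c)]}" using v by simp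
    qed
    then have "card (det_tuples 1 c S) \<le> card {[vec 1 (\<lambda>_. c)]}"
      by (rule card_mono[rotated]) simp
    then show ?thesis using False S by simp
  qed
  then show ?case by (intro exI[of _ 1]) auto
next
  case (step D)
  define e d where "e = real D - 2 / (real D + 1)" and "d = Suc D"
  have D: "D \<ge> 1" by fact
  have "2 / (real D + 1) \<le> 1" using D by simp
  then have e: "e \<ge> 0" using D unfolding e_def by linarith
  obtain C where C: "C > 0" "\<And>c T. \<lbrakk>c \<noteq> 0; finite T; T \<subseteq> carrier_vec D\<rbrakk> \<Longrightarrow> real (card (det_tuples D c T)) \<le> C * real (card T) powr e"
    using step.IH unfolding e_def by blast
  define B where "B = C * (2 * real D) powr e + 2056 * real D"
  have "real (card (det_tuples d c S)) \<le> B * real (card S) powr (real d - 2 / (real d + 1))"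
    if c: "c \<noteq> 0" and S: "finite S" "S \<subseteq> carrier_vec d" for c S
  proof (cases "S = {}")
    case True
    then show ?thesis by (simp add: det_tuples_def d_def card_eq_0_iff)
  next
    case False
    \<comment> \<open>The balancing value is \<open>x\<close>; rounding it down costs at most a factor \<open>2\<close> because \<open>x \<ge> 1\<close>.\<close>
    define n x m where "n = real (card S)" and "x = n powr (1 / (real d + 1))" and "m = nat \<lfloor>x\<rfloor>"
    have n: "n \<ge> 1" using False S by (simp add: n_def Suc_leI card_gt_0_iff)
    have x1: "x \<ge> 1" using n by (simp add: x_def ge_one_powr_ge_zero)
    have "\<lfloor>x\<rfloor> \<ge> 1" using x1 by simp
    then have "real m = of_int \<lfloor>x\<rfloor>" "real m \<ge> 1" by (simp_all add: m_def)
    then have m: "m \<ge> 1" "real m \<le> x" "x \<le> 2 * real m" by linarith+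
    have "x \<le> n powr 1" unfolding x_def using n by (intro powr_mono) auto
    then have mn: "real m \<le> n" using m n by simp
    define H where "H i = {vs \<in> det_tuples d c S. m < card (parallels S (hd vs) (tl vs ! i))}" for i
    define I where "I u = {y \<in> S. card (parallels S u y) \<le> m}" for u
    define L where "L u = {ws. set ws \<subseteq> I u \<and> length ws = D \<and> det (mat_of_cols d (u # ws)) = c}" for u
    have fI: "finite (I u)" "card (I u) \<le> card S" for u using S
      by (auto simp: I_def intro: card_mono)
    have fL: "finite (L u)" for u
      by (rule finite_subset[OF _ finite_lists_length_eq[OF fI(1)[of u], of D]]) (auto simp: L_def)
    have "det_tuples d c S \<subseteq> (\<Union>i<D. H i) \<union> (\<Union>u\<in>S. (#) u ` L u)"
    proof
      fix vs assume vs: "vs \<in> det_tuples d c S"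
      then obtain u ws where v: "vs = u # ws" "u \<in> S" "set ws \<subseteq> S" "length ws = D" "det (mat_of_cols d (u # ws)) = c"
        by (cases vs) (auto simp: det_tuples_def d_def)
      show "vs \<in> (\<Union>i<D. H i) \<union> (\<Union>u\<in>S. (#) u ` L u)"
      proof (cases "set ws \<subseteq> I u")
        case True
        then show ?thesis using v by (auto simp: L_def)
      next
        case False
        then obtain i where i: "i < D" "ws ! i \<notin> I u" using v
          by (metis in_set_conv_nth subsetI)
        then have "ws ! i \<in> S" using v by (metis nth_mem subsetD)
        then have "m < card (parallels S u (ws ! i))" using i by (simp add: I_def)
        then have "vs \<in> H i" using vs v by (simp add: H_def)
        then show ?thesis using i by auto
      qed
    qed
    then have "card (det_tuples d c S) \<le> card ((\<Union>i<D. H i) \<union> (\<Union>u\<in>S. (#) u ` L u))"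
      using S fL finite_det_tuples[OF S(1), of d c] by (intro card_mono) (auto simp: H_def)
    also have "\<dots> \<le> (\<Sum>i<D. card (H i)) + (\<Sum>u\<in>S. card ((#) u ` L u))"
      using S by (intro order_trans[OF card_Un_le] add_mono card_UN_le) auto
    also have "(\<Sum>u\<in>S. card ((#) u ` L u)) = (\<Sum>u\<in>S. card (L u))"
      by (intro sum.cong) (auto simp: card_image inj_on_def)
    finally have "real (card (det_tuples d c S)) \<le> real ((\<Sum>i<D. card (H i)) + (\<Sum>u\<in>S. card (L u)))" by (rule of_nat_mono)
    then have split: "real (card (det_tuples d c S)) \<le> (\<Sum>i<D. real (card (H i))) + (\<Sum>u\<in>S. real (card (L u)))" by simp
    have expo: "real d - 2 / (real d + 1) = 1 + e + 1 / (real d + 1) * (2 / (real D + 1))"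
    proof -
      define a where "a = real D + 1"
      have a: "a > 0" "real D = a - 1" "real d = a" by (simp_all add: a_def d_def)
      have "1 / (a + 1) * (2 / a) = 2 / a - 2 / (a + 1)" using a(1) by (simp add: field_simps)
      then show ?thesis unfolding e_def a(2,3) by simp
    qed
    have light: "real (card (L u)) \<le> C * (2 * real D) powr e * (n powr e * x powr (2 / (real D + 1)))" if u: "u \<in> S" for u
    proof -
      have "parallels (I u) u y \<subseteq> parallels S u y" for y
        by (auto simp: parallels_def I_def)
      then have "card (parallels (I u) u y) \<le> m" if "y \<in> I u" for y
        using that card_mono[of "parallels S u y" "parallels (I u) u y"] S
        by (auto simp: I_def parallels_def)
      then have "real (card (L u)) \<le> real m ^ D * (C * (real D * (real (card (I u)) / real m + 1)) powr e)"
        unfolding L_def d_def using S u c m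
        by (intro count_light_tuples[OF C(2) C(1) e fI(1)]) (auto simp: I_def d_def)
      also have "\<dots> \<le> real m ^ D * (C * ((2 * real D) * (n / real m)) powr e)"
      proof -
        have "real (card (I u)) / real m + 1 \<le> n / real m + n / real m"
          using fI(2)[of u] m mn by (intro add_mono divide_right_mono) (auto simp: n_def)
        then have "real D * (real (card (I u)) / real m + 1) \<le> real D * (n / real m + n / real m)"
          by (intro mult_left_mono) auto
        also have "\<dots> = (2 * real D) * (n / real m)" by simp
        finally show ?thesis using C(1) e by (intro mult_left_mono powr_mono2) auto
      qed
      also have "\<dots> = C * (2 * real D) powr e * (n powr e * real m powr (2 / (real D + 1)))"
      proof -
        have 1: "((2 * real D) * (n / real m)) powr e = (2 * real D) powr e * (n powr e / real m powr e)"
          using n m D by (simp add: powr_mult powr_divide)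
        have "real m ^ D = real m powr (e + 2 / (real D + 1))"
          using m by (simp add: powr_realpow e_def)
        then have 2: "real m ^ D = real m powr e * real m powr (2 / (real D + 1))"
          by (simp add: powr_add)
        show ?thesis unfolding 1 2 using m by simp
      qed
      also have "\<dots> \<le> C * (2 * real D) powr e * (n powr e * x powr (2 / (real D + 1)))"
        using C(1) m by (intro mult_left_mono powr_mono2) auto
      finally show ?thesis .
    qed
    have "(\<Sum>u\<in>S. real (card (L u))) \<le> (\<Sum>u\<in>S. C * (2 * real D) powr e * (n powr e * x powr (2 / (real D + 1))))"
      by (intro sum_mono light)
    also have "\<dots> = C * (2 * real D) powr e * (n powr 1 * n powr e * x powr (2 / (real D + 1)))"
      using n by (simp add: n_def)
    also have "n powr 1 * n powr e * x powr (2 / (real D + 1)) = n powr (real d - 2 / (real d + 1))"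
      unfolding x_def powr_powr expo by (simp add: powr_add)
    finally have L: "(\<Sum>u\<in>S. real (card (L u))) \<le> C * (2 * real D) powr e * n powr (real d - 2 / (real d + 1))" .
    \<comment> \<open>As \<open>d \<ge> 2\<close>, the term \<open>n\<close> of the incidence bound is dominated by \<open>n^2 / x^2\<close>.\<close>
    have xn: "x ^ 2 \<le> n"
    proof -
      have "x ^ 2 = n powr (2 / (real d + 1))" unfolding x_def using n
        by (simp add: powr_powr powr_realpow[symmetric])
      also have "\<dots> \<le> n powr 1" using n by (intro powr_mono) (auto simp: d_def)
      finally show ?thesis using n by simp
    qed
    have heavy: "real (card (H i)) \<le> 2056 * n powr (real d - 2 / (real d + 1))"
      if i: "i < D" for i
    proof -
      have "real (card (H i)) \<le> (512 * n ^ 2 / real m ^ 2 + 8 * n) * n ^ (D - 1)"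
        unfolding H_def d_def n_def using count_heavy_tuples[OF S(1) _ m(1) c i] S(2)
        by (simp add: d_def)
      also have "\<dots> \<le> (2048 * (n ^ 2 / x ^ 2) + 8 * (n ^ 2 / x ^ 2)) * n ^ (D - 1)"
      proof (intro mult_right_mono add_mono)
        have "x ^ 2 \<le> 4 * real m ^ 2" using power_mono[OF m(3), of 2] x1
          by (simp add: power_mult_distrib)
        then have "n ^ 2 / (4 * real m ^ 2) \<le> n ^ 2 / x ^ 2" using x1 m
          by (intro divide_left_mono) auto
        then show "512 * n ^ 2 / real m ^ 2 \<le> 2048 * (n ^ 2 / x ^ 2)" by simp
        have "n * x ^ 2 \<le> n * n" using xn n by (intro mult_left_mono) auto
        then show "8 * n \<le> 8 * (n ^ 2 / x ^ 2)" using x1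
          by (simp add: pos_le_divide_eq power2_eq_square)
      qed (use n in auto)
      also have "\<dots> = 2056 * (n ^ 2 * n ^ (D - 1) / x ^ 2)" by (simp add: algebra_simps)
      also have "n ^ 2 * n ^ (D - 1) = n ^ d" using D by (simp add: power_add[symmetric] d_def)
      also have "n ^ d / x ^ 2 = n powr (real d - 2 / (real d + 1))"
        unfolding x_def using n by (simp add: powr_powr powr_realpow[symmetric] powr_diff)
      finally show ?thesis .
    qed
    have "(\<Sum>i<D. real (card (H i))) \<le> (\<Sum>i<D. 2056 * n powr (real d - 2 / (real d + 1)))"
      by (intro sum_mono heavy) auto
    also have "\<dots> = 2056 * real D * n powr (real d - 2 / (real d + 1))" by simp
    finally show ?thesis using split L unfolding B_def n_def by (simp add: algebra_simps)
  qed
  moreover have "B > 0" using C(1) D by (simp add: B_def add_nonneg_pos)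
  ultimately show ?case unfolding d_def by blast
qed

section \<open>Minors as lists of columns\<close>

lemma pick_strict_sorted:
  assumes "sorted_wrt (<) js" "j < length js"
  shows "pick (set js) j = js ! j"
proof -
  have less: "js ! a < js ! b \<longleftrightarrow> a < b"
    if "a < length js" "b < length js" for a b
    using assms(1) that by (metis linorder_neqE_nat order_less_asym sorted_wrt_iff_nth_less)
  have "{a \<in> set js. a < js ! j} = (\<lambda>i. js ! i) ` {..<j}"
    using assms(2) less by (auto simp: set_conv_nth)
  moreover have "inj_on (\<lambda>i. js ! i) {..<j}"
    using less assms(2) by (intro inj_onI) (metis lessThan_iff nat_neq_iff order.strict_trans)
  ultimately have "card {a \<in> set js. a < js ! j} = j" by (simp add: card_image)
  then show ?thesis using pick_card_in_set[of "js ! j" "set js"] assms(2) by simp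
qed

lemma submatrix_sorted_columns:
  assumes "sorted_wrt (<) js" "set js \<subseteq> {0..<dim_col A}"
  shows "submatrix A UNIV (set js) = mat_of_cols (dim_row A) (map (col A) js)"
proof -
  have "{j. j < dim_col A \<and> j \<in> set js} = set js" using assms(2) by auto
  moreover have "card (set js) = length js" using assms(1)
    by (simp add: distinct_card strict_sorted_iff)
  ultimately have dims: "card {j. j < dim_col A \<and> j \<in> set js} = length js" by simp
  show ?thesis
  proof (rule eq_matI)
    fix i j assume "i < dim_row (mat_of_cols (dim_row A) (map (col A) js))"
      "j < dim_col (mat_of_cols (dim_row A) (map (col A) js))"
    then have ij: "i < dim_row A" "j < length js" by auto
    have "submatrix A UNIV (set js) $$ (i, j) = A $$ (pick UNIV i, pick (set js) j)"
      using ij dims by (intro submatrix_index) auto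
    also have "\<dots> = A $$ (i, js ! j)" using pick_strict_sorted[OF assms(1) ij(2)]
      by (simp add: pick_UNIV)
    also have "js ! j < dim_col A" using assms(2) ij by (meson atLeastLessThan_iff nth_mem subsetD)
    then have "A $$ (i, js ! j) = mat_of_cols (dim_row A) (map (col A) js) $$ (i, j)"
      using ij by (simp add: mat_of_cols_index)
    finally show "submatrix A UNIV (set js) $$ (i, j) = mat_of_cols (dim_row A) (map (col A) js) $$ (i, j)" .
  qed (auto simp: dim_submatrix dims)
qed

lemma card_unit_minors_le_tuples:
  assumes A: "A \<in> carrier_mat d n" and dist: "distinct (cols A)"
  shows "card (unit_minors A) \<le> card (det_tuples d 1 (set (cols A)))"
proof (rule card_inj_on_le[of "\<lambda>J. map (col A) (sorted_list_of_set J)"])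
  have fin: "finite J" if "J \<in> unit_minors A" for J
    using that by (auto simp: unit_minors_def intro: finite_subset)
  show "inj_on (\<lambda>J. map (col A) (sorted_list_of_set J)) (unit_minors A)"
  proof (rule inj_onI)
    fix J K assume J: "J \<in> unit_minors A" and K: "K \<in> unit_minors A"
      and eq: "map (col A) (sorted_list_of_set J) = map (col A) (sorted_list_of_set K)"
    have "inj_on (col A) {0..<n}"
      using dist A unfolding cols_def distinct_map by simp
    moreover have "J \<subseteq> {0..<n}" "K \<subseteq> {0..<n}" using J K A
      by (auto simp: unit_minors_def)
    moreover have "col A ` J = col A ` K" using eq fin[OF J] fin[OF K]
      by (metis list.set_map set_sorted_list_of_set)
    ultimately show "J = K" by (meson inj_on_image_eq_iff)
  qed
  show "(\<lambda>J. map (col A) (sorted_list_of_set J)) ` unit_minors A \<subseteq> det_tuples d 1 (set (cols A))"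
  proof (rule image_subsetI)
    fix J assume J: "J \<in> unit_minors A"
    then have *: "J \<subseteq> {0..<n}" "card J = d" "det (submatrix A UNIV J) = 1"
      using A by (auto simp: unit_minors_def)
    have "submatrix A UNIV J = mat_of_cols d (map (col A) (sorted_list_of_set J))"
      using submatrix_sorted_columns[of "sorted_list_of_set J" A] fin[OF J] *(1) A by simp
    then show "map (col A) (sorted_list_of_set J) \<in> det_tuples d 1 (set (cols A))"
      using * fin[OF J] A by (auto simp: det_tuples_def cols_def)
  qed
qed (rule finite_det_tuples, simp)

text \<open>
  A partial list of columns is completed to \<open>n\<close> columns by arbitrary new vectors; increasing
  position lists are the same as sets of column indices.
\<close>
lemma max_unit_minors_ge:
  fixes cs :: "real vec list"
  assumes d: "d \<ge> 1" and cs: "set cs \<subseteq> carrier_vec d" "distinct cs" "length cs \<le> n"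
  shows "card {js. sorted_wrt (<) js \<and> set js \<subseteq> {0..<length cs} \<and> length js = d \<and>
           det (mat_of_cols d (map ((!) cs) js)) = 1} \<le> max_unit_minors d n" (is "card ?J \<le> _")
proof -
  have "inj (\<lambda>t :: real. vec d (\<lambda>_. t))"
  proof (rule injI)
    fix s t :: real assume "vec d (\<lambda>_. s) = vec d (\<lambda>_. t)"
    then have "vec d (\<lambda>_. s) $ 0 = vec d (\<lambda>_. t) $ 0" by simp
    then show "s = t" using d by simp
  qed
  moreover have "range (\<lambda>t :: real. vec d (\<lambda>_. t)) \<subseteq> carrier_vec d"
    by auto
  ultimately have "infinite (carrier_vec d :: real vec set)"
    using finite_imageD[of "\<lambda>t :: real. vec d (\<lambda>_. t)" UNIV] infinite_UNIV_char_0[where ?'a = real]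
    by (meson finite_subset)
  then have "infinite (carrier_vec d - set cs)" by simp
  then obtain X where X: "finite X" "card X = n - length cs" "X \<subseteq> carrier_vec d - set cs"
    using infinite_arbitrarily_large by blast
  obtain xs where xs: "set xs = X" "distinct xs" using finite_distinct_list[OF X(1)] by auto
  define ds where "ds = cs @ xs"
  define A where "A = mat_of_cols d ds"
  have ds: "set ds \<subseteq> carrier_vec d" "distinct ds" "length ds = n"
    using cs X xs distinct_card[of xs] by (auto simp: ds_def)
  have A: "A \<in> carrier_mat d n" "distinct (cols A)"
    using ds mat_of_cols_carrier(1)[of d ds] by (auto simp: A_def)
  have "card ?J \<le> card (unit_minors A)"
  proof (rule card_inj_on_le[of set])
    show "inj_on set ?J" by (rule inj_onI) (blast intro: strict_sorted_equal)
    show "set ` ?J \<subseteq> unit_minors A"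
    proof (rule image_subsetI)
      fix js assume "js \<in> ?J"
      then have js: "sorted_wrt (<) js" "set js \<subseteq> {0..<length cs}" "length js = d"
        "det (mat_of_cols d (map ((!) cs) js)) = 1" by auto
      have sub: "set js \<subseteq> {0..<dim_col A}" using js(2) cs(3) A by auto
      have cols: "map (col A) js = map ((!) cs) js"
      proof (rule map_cong[OF refl])
        fix j assume "j \<in> set js"
        then have j: "j < length cs" using js(2) by auto
        then have "ds ! j = cs ! j" by (simp add: ds_def nth_append)
        moreover have "ds ! j \<in> carrier_vec d" 
          using j ds(1) nth_mem[of j ds] by (auto simp: ds_def)
        ultimately show "col A j = cs ! j" using j unfolding A_def
          by (subst col_mat_of_cols) (auto simp: ds_def)
      qed
      have "det (submatrix A UNIV (set js)) = 1"
        unfolding submatrix_sorted_columns[OF js(1) sub] cols using js(4) A(1) by simp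
      moreover have "card (set js) = d" using js(1,3) by (simp add: distinct_card strict_sorted_iff)
      ultimately show "set js \<in> unit_minors A" using sub A(1) by (simp add: unit_minors_def)
    qed
    show "finite (unit_minors A)"
      by (rule finite_subset[of _ "Pow {0..<dim_col A}"]) (auto simp: unit_minors_def)
  qed
  also have "\<dots> \<le> max_unit_minors d n"
    unfolding max_unit_minors_def using A by (intro Max_ge finite_unit_minor_counts) auto
  finally show ?thesis .
qed

text \<open>
  If the columns are listed class after class, then a choice of one column from each class, in
  the order of the classes, occupies increasing positions. So the minor on these positions is the
  determinant of the chosen list, without a change of sign.
\<close>
lemma increasing_positions:
  assumes "list_all2 (\<lambda>v L. v \<in> set L) vs Ls"
  shows "\<exists>js. sorted_wrt (<) js \<and> set js \<subseteq> {0..<length (concat Ls)} \<and> map ((!) (concat Ls)) js = vs"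
  using assms
proof (induction vs Ls rule: list_all2_induct)
  case Nil
  show ?case by (intro exI[of _ "[]"]) simp
next
  case (Cons v vs L Ls)
  then obtain js where js: "sorted_wrt (<) js" "set js \<subseteq> {0..<length (concat Ls)}" "map ((!) (concat Ls)) js = vs"
    by auto
  obtain p where p: "p < length L" "L ! p = v" using Cons by (auto simp: in_set_conv_nth)
  show ?case
    using js p
    by (intro exI[of _ "p # map (\<lambda>i. length L + i) js"])
      (auto simp: sorted_wrt_map nth_append comp_def)
qed

lemma max_unit_minors_ge_classes:
  fixes G :: "nat \<Rightarrow> real vec set"
  assumes d: "d \<ge> 1" and G: "\<And>j. j < d \<Longrightarrow> finite (G j)" "\<And>j. j < d
    \<Longrightarrow> G j \<subseteq> carrier_vec d"
    and disj: "\<And>i j. i < j \<Longrightarrow> j < d \<Longrightarrow> G i \<inter> G j = {}"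
    and n: "(\<Sum>j<d. card (G j)) \<le> n"
  shows "card {vs. length vs = d \<and> (\<forall>j<d. vs ! j \<in> G j) \<and> det (mat_of_cols d vs) = 1} \<le> max_unit_minors d n"
    (is "card ?T \<le> _")
proof -
  define L where "L j = (SOME xs. set xs = G j \<and> distinct xs)" for j
  have L: "set (L j) = G j \<and> distinct (L j)" if "j < d" for j
    unfolding L_def by (rule someI_ex) (use finite_distinct_list[OF G(1)[OF that]] in auto)
  have dist: "distinct (concat (map L [0..<k]))" if "k \<le> d" for k
    using that
  proof (induction k)
    case (Suc k)
    have "set (concat (map L [0..<k])) \<inter> set (L k) = {}"
      using Suc.prems L disj by fastforce
    then show ?case using Suc L[of k] by simp
  qed simp
  define cs where "cs = concat (map L [0..<d])"
  have cs: "set cs \<subseteq> carrier_vec d" "distinct cs"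
    using L G dist[of d] by (fastforce simp: cs_def)+
  have "length (L j) = card (G j)" if "j < d" for j using L[OF that] distinct_card by fastforce
  then have "length cs = sum_list (map (\<lambda>j. card (G j)) [0..<d])"
    unfolding cs_def length_concat map_map
    by (intro arg_cong[where f = sum_list] map_cong refl) simp
  also have "\<dots> = (\<Sum>j<d. card (G j))"
    by (simp add: interv_sum_list_conv_sum_set_nat atLeast0LessThan)
  finally have len: "length cs \<le> n" using n by simp
  let ?J = "{js. sorted_wrt (<) js \<and> set js \<subseteq> {0..<length cs} \<and> length js = d \<and>
           det (mat_of_cols d (map ((!) cs) js)) = 1}"
  have "?T \<subseteq> map ((!) cs) ` ?J"
  proof
    fix vs assume vs: "vs \<in> ?T"
    then have "list_all2 (\<lambda>v L. v \<in> set L) vs (map L [0..<d])"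
      using L by (auto simp: list_all2_conv_all_nth)
    from increasing_positions[OF this] obtain js where
      js: "sorted_wrt (<) js" "set js \<subseteq> {0..<length cs}" "map ((!) cs) js = vs"
      unfolding cs_def[symmetric] by auto
    then have "js \<in> ?J" using vs by (auto simp flip: js(3))
    then show "vs \<in> map ((!) cs) ` ?J" using js(3) by blast
  qed
  moreover have "finite ?J"
    by (rule finite_subset[OF _ finite_lists_length_eq[of "{0..<length cs}" d]]) auto
  ultimately have "card ?T \<le> card ?J" by (meson surj_card_le)
  also have "\<dots> \<le> max_unit_minors d n" by (rule max_unit_minors_ge[OF d cs len])
  finally show ?thesis .
qed

section \<open>The lower bound\<close>

lemma det_two_by_two:
  assumes "A \<in> carrier_mat 2 2"
  shows "det (A :: real mat) = A $$ (0, 0) * A $$ (1, 1) - A $$ (0, 1) * A $$ (1, 0)"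
proof -
  have d1: "det (mat_delete A i 0) = mat_delete A i 0 $$ (0, 0)" if "i < 2" for i
    using assms that by (intro det_single) (auto simp: mat_delete_def)
  have "det A = (\<Sum>i<2. A $$ (i, 0) * cofactor A i 0)"
    by (rule laplace_expansion_column[OF assms]) simp
  also have "\<dots> = A $$ (0, 0) * cofactor A 0 0 + A $$ (1, 0) * cofactor A 1 0"
    by (simp add: numeral_2_eq_2)
  also have "cofactor A 0 0 = A $$ (1, 1)"
    unfolding cofactor_def using d1[of 0] assms by (simp add: mat_delete_def)
  also have "cofactor A 1 0 = - A $$ (0, 1)"
    unfolding cofactor_def using d1[of 1] assms by (simp add: mat_delete_def)
  finally show ?thesis by (simp add: mult.commute)
qed

definition planar_vec :: "nat \<Rightarrow> real \<Rightarrow> real \<Rightarrow> real vec" where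
  "planar_vec d a b = vec d (\<lambda>i. if i = 0 then a else if i = 1 then b else 0)"

text \<open>
  The vector \<open>e_j + s e_0\<close>.
\<close>
definition sheared_unit :: "nat \<Rightarrow> nat \<Rightarrow> real \<Rightarrow> real vec" where
  "sheared_unit d j s = vec d (\<lambda>i. if i = 0 then s else if i = j then 1 else 0)"

lemma det_planar_sheared:
  assumes d: "d \<ge> 2" and ss: "length ss = d - 2"
  shows "det (mat_of_cols d ([planar_vec d a b, planar_vec d x y] @ map (\<lambda>j. sheared_unit d j (ss ! (j - 2))) [2..<d]))
           = a * y - b * x"
proof -
  let ?vs = "[planar_vec d a b, planar_vec d x y] @ map (\<lambda>j. sheared_unit d j (ss ! (j - 2))) [2..<d]"
  let ?M = "mat_of_cols d ?vs"
  define A1 where "A1 = mat 2 2 (\<lambda>(i, j). ?M $$ (i, j))"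
  define A2 where "A2 = mat 2 (d - 2) (\<lambda>(i, j). ?M $$ (i, j + 2))"
  have len: "length ?vs = d" using d by simp
  have entry: "?M $$ (i, j) = (if j = 0 then planar_vec d a b else if j = 1 then planar_vec d x y
        else sheared_unit d j (ss ! (j - 2))) $ i" if "i < d" "j < d" for i j
  proof -
    have "?M $$ (i, j) = ?vs ! j $ i" using that len by (intro mat_of_cols_index) auto
    also have "?vs ! j = (if j = 0 then planar_vec d a b else if j = 1 then planar_vec d x y
        else sheared_unit d j (ss ! (j - 2)))"
      using that by (auto simp: nth_Cons nth_append split: nat.split)
    finally show ?thesis .
  qed
  have "?M = four_block_mat A1 A2 (0\<^sub>m (d - 2) 2) (1\<^sub>m (d - 2))"
  proof (rule eq_matI)
    fix i j assume "i < dim_row (four_block_mat A1 A2 (0\<^sub>m (d - 2) 2) (1\<^sub>m (d - 2)))"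
      "j < dim_col (four_block_mat A1 A2 (0\<^sub>m (d - 2) 2) (1\<^sub>m (d - 2)))"
    then have ij: "i < d" "j < d" using d by (auto simp: A1_def A2_def)
    show "?M $$ (i, j) = four_block_mat A1 A2 (0\<^sub>m (d - 2) 2) (1\<^sub>m (d - 2)) $$ (i, j)"
    proof (cases "i < 2")
      case True
      moreover have "Suc (Suc (j - 2)) = j" if "\<not> j < 2" using that by simp
      ultimately show ?thesis using ij d by (auto simp: A1_def A2_def)
    next
      case False
      then show ?thesis
        using ij d unfolding entry[OF ij]
        by (auto simp: A1_def A2_def planar_vec_def sheared_unit_def)
    qed
  qed (use d len in \<open>auto simp: A1_def A2_def\<close>)
  then have "det ?M = det A1 * det (1\<^sub>m (d - 2) :: real mat)"
    using det_four_block_mat_lower_left_zero[of A1 2 A2 "d - 2" "0\<^sub>m (d - 2) 2" "1\<^sub>m (d - 2)"]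
    by (simp add: A1_def A2_def)
  also have "\<dots> = A1 $$ (0, 0) * A1 $$ (1, 1) - A1 $$ (0, 1) * A1 $$ (1, 0)"
    by (simp add: det_two_by_two A1_def)
  also have "\<dots> = a * y - b * x"
    using d entry[of 0 0] entry[of 0 1] entry[of 1 0] entry[of 1 1]
    by (simp add: A1_def planar_vec_def algebra_simps)
  finally show ?thesis .
qed

text \<open>
  In the class \<open>0\<close> are the vectors \<open>(1/c, m/c)\<close>, in the class \<open>1\<close> a grid that contains all
  points \<open>(x, m x + c)\<close>, and in each class \<open>j \<ge> 2\<close> the vectors \<open>e_j + s e_0\<close>. The abscissae of the
  grid start at \<open>2\<close>, as the classes must be disjoint and the first coordinates in class \<open>0\<close> reach
  \<open>1\<close>. The sizes of the classes add up to at most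
  \<open>k^3 + 3 k^3 + (d - 2) k^3\<close>.
\<close>
lemma many_unit_minors:
  assumes d: "d \<ge> 2" and k: "k \<ge> 1" and n: "(d + 2) * k ^ 3 \<le> n"
  shows "k ^ (3 * d - 2) \<le> max_unit_minors d n"
proof -
  define G where "G j = (if j = 0 then (\<lambda>(c, m). planar_vec d (1 / real c) (real m / real c)) ` ({1..k ^ 2} \<times> {1..k})
     else if j = 1 then (\<lambda>(x, y). planar_vec d (real x) (real y)) ` ({2..k + 1} \<times> {1..3 * k ^ 2})
     else (\<lambda>s. sheared_unit d j (real s)) ` {1..k ^ 3})" for j
  define T where "T = {vs. length vs = d \<and> (\<forall>j<d. vs ! j \<in> G j) \<and> det (mat_of_cols d vs) = 1}"
  have nth: "planar_vec d a b $ 0 = a" "planar_vec d a b $ Suc 0 = b" "\<And>i. i < d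
    \<Longrightarrow> 1 < i \<Longrightarrow> planar_vec d a b $ i = 0" for a b
    using d by (auto simp: planar_vec_def)
  have nth': "sheared_unit d j s $ 0 = s" "\<And>i. i < d \<Longrightarrow> 0 < i
    \<Longrightarrow> sheared_unit d j s $ i = (if i = j then 1 else 0)" for j s
    using d by (auto simp: sheared_unit_def)
  have carrier: "G j \<subseteq> carrier_vec d" for j
    by (auto simp: G_def planar_vec_def sheared_unit_def)
  have fin: "finite (G j)" for j by (simp add: G_def)
  have disj: "G i \<inter> G j = {}" if ij: "i < j" "j < d" for i j
  proof (cases "j = 1")
    case True
    have "v $ 0 \<le> 1" if "v \<in> G 0" for v using that by (auto simp: G_def nth)
    moreover have "v $ 0 \<ge> 2" if "v \<in> G 1" for v using that by (auto simp: G_def nth)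
    ultimately show ?thesis using True ij by fastforce
  next
    case False
    then have j: "j > 1" using ij by simp
    have "v $ j = 0" if "v \<in> G i" for v using that ij j
      by (auto simp: G_def nth nth' split: if_splits)
    moreover have "v $ j = 1" if "v \<in> G j" for v using that ij j by (auto simp: G_def nth')
    ultimately show ?thesis by fastforce
  qed
  have "(\<Sum>j<d. card (G j)) = card (G 0) + card (G 1) + (\<Sum>j=2..<d. card (G j))"
  proof -
    have "{..<d} = {0, 1} \<union> {2..<d}" using d by auto
    then show ?thesis by (simp add: sum.union_disjoint)
  qed
  also have "card (G 0) \<le> k ^ 3"
  proof -
    have "card (G 0) \<le> card ({1..k ^ 2} \<times> {1..k})" unfolding G_def
      by (simp only: if_True refl) (rule card_image_le, simp)
    also have "\<dots> = k ^ 3"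
      by (simp add: card_cartesian_product power2_eq_square power3_eq_cube)
    finally show ?thesis .
  qed
  also have "card (G 1) \<le> 3 * k ^ 3"
  proof -
    have "card (G 1) = card ((\<lambda>(x, y). planar_vec d (real x) (real y)) ` ({2..k + 1} \<times> {1..3 * k ^ 2}))"
      by (simp add: G_def)
    also have "\<dots> \<le> card ({2..k + 1} \<times> {1..3 * k ^ 2})" by (rule card_image_le) simp
    also have "\<dots> = 3 * k ^ 3"
      by (simp add: card_cartesian_product power2_eq_square power3_eq_cube)
    finally show ?thesis .
  qed
  also have "(\<Sum>j=2..<d. card (G j)) \<le> (\<Sum>j=2..<d. k ^ 3)"
  proof (rule sum_mono)
    fix j assume "j \<in> {2..<d}"
    then have "card (G j) = card ((\<lambda>s. sheared_unit d j (real s)) ` {1..k ^ 3})"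
      by (simp add: G_def)
    also have "\<dots> \<le> card {1..k ^ 3}" by (rule card_image_le) simp
    finally show "card (G j) \<le> k ^ 3" by simp
  qed
  finally have "(\<Sum>j<d. card (G j)) \<le> k ^ 3 + 3 * k ^ 3 + (d - 2) * k ^ 3" by simp
  also have "\<dots> = (1 + 3 + (d - 2)) * k ^ 3" by (simp only: distrib_right mult_1)
  also have "1 + 3 + (d - 2) = d + 2" using d by simp
  finally have size: "(\<Sum>j<d. card (G j)) \<le> n" using n by simp
  define W where "W = {ss. set ss \<subseteq> {1..k ^ 3} \<and> length ss = d - 2}"
  have W: "finite W" "card W = (k ^ 3) ^ (d - 2)"
    unfolding W_def using finite_lists_length_eq[of "{1..k ^ 3}"] card_lists_length_eq[of "{1..k ^ 3}"] by auto
  define F where "F = (\<lambda>(x :: nat, m :: nat, c :: nat, ss :: nat list).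
     [planar_vec d (1 / real c) (real m / real c), planar_vec d (real x) (real (m * x + c))]
       @ map (\<lambda>j. sheared_unit d j (map real ss ! (j - 2))) [2..<d])"
  let ?D = "{2..k + 1} \<times> {1..k} \<times> {1..k ^ 2} \<times> W"
  have "card ?D \<le> card T"
  proof (rule card_inj_on_le[of F])
    show "inj_on F ?D"
    proof (rule inj_onI)
      fix p q assume p: "p \<in> ?D" and q: "q \<in> ?D" and eq: "F p = F q"
      obtain x m c ss where p': "p = (x, m, c, ss)" by (metis surj_pair)
      obtain x' m' c' ss' where q': "q = (x', m', c', ss')" by (metis surj_pair)
      have pos: "c > 0" "c' > 0" using p q by (auto simp: p' q')
      have e: "planar_vec d (1 / real c) (real m / real c) = planar_vec d (1 / real c') (real m' / real c')"
        "planar_vec d (real x) (real (m * x + c)) = planar_vec d (real x') (real (m' * x' + c'))"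
        "map (\<lambda>j. sheared_unit d j (map real ss ! (j - 2))) [2..<d] = map (\<lambda>j. sheared_unit d j (map real ss' ! (j - 2))) [2..<d]"
        using eq by (simp_all add: F_def p' q')
      have c: "c = c'" using arg_cong[OF e(1), of "\<lambda>v. v $ 0"] pos by (simp add: nth)
      have m: "m = m'" using arg_cong[OF e(1), of "\<lambda>v. v $ Suc 0"] pos c by (simp add: nth)
      have x: "x = x'" using arg_cong[OF e(2), of "\<lambda>v. v $ 0"] by (simp add: nth)
      have l: "length ss = d - 2" "length ss' = d - 2" using p q by (auto simp: p' q' W_def)
      have "ss = ss'"
      proof (rule nth_equalityI)
        fix i assume i: "i < length ss"
        then have "sheared_unit d (i + 2) (real (ss ! i)) = sheared_unit d (i + 2) (real (ss' ! i))"
          using arg_cong[OF e(3), of "\<lambda>l. l ! i"] l by (simp add: nth_map_upt)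
        from arg_cong[OF this, of "\<lambda>v. v $ 0"] show "ss ! i = ss' ! i" by (simp add: nth')
      qed (use l in simp)
      then show "p = q" using c m x by (simp add: p' q')
    qed
    show "F ` ?D \<subseteq> T"
    proof (rule image_subsetI)
      fix p assume p: "p \<in> ?D"
      obtain x m c ss where p': "p = (x, m, c, ss)" by (metis surj_pair)
      have r: "2 \<le> x" "x \<le> k + 1" "1 \<le> m" "m \<le> k" "1 \<le> c" "c \<le> k ^ 2" "ss \<in> W" using p by (auto simp: p')
      have ss: "length ss = d - 2" "\<And>i. i < d - 2 \<Longrightarrow> ss ! i \<in> {1..k ^ 3}"
        using r(7) unfolding W_def
        by (simp, metis (mono_tags, lifting) mem_Collect_eq nth_mem subsetD)
      have "m * x + c \<le> k * (k + 1) + k ^ 2" using r by (intro add_mono mult_mono) auto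
      also have "\<dots> \<le> 3 * k ^ 2" using k by (simp add: power2_eq_square)
      finally have y: "m * x + c \<le> 3 * k ^ 2" .
      have "F p ! j \<in> G j" if j: "j < d" for j
      proof -
        consider "j = 0" | "j = 1" | "j \<ge> 2" by linarith
        then show ?thesis
        proof cases
          case 1
          then show ?thesis using r by (auto simp: F_def p' G_def)
        next
          case 2
          have "F p ! 1 = (\<lambda>(x, y). planar_vec d (real x) (real y)) (x, m * x + c)"
            by (simp add: F_def p')
          moreover have "(x, m * x + c) \<in> {2..k + 1} \<times> {1..3 * k ^ 2}" using r y by auto
          ultimately have "F p ! 1 \<in> (\<lambda>(x, y). planar_vec d (real x) (real y)) ` ({2..k + 1} \<times> {1..3 * k ^ 2})" by blast
          then show ?thesis using 2 by (simp add: G_def)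
        next
          case 3
          then have "F p ! j = sheared_unit d j (real (ss ! (j - 2)))"
            using j ss by (simp add: F_def p' nth_append nth_Cons numeral_2_eq_2 split: nat.split)
          then show ?thesis using 3 ss(2)[of "j - 2"] j by (simp add: G_def)
        qed
      qed
      moreover have "det (mat_of_cols d (F p)) = 1"
        unfolding F_def p' prod.case using d ss(1) r
        by (subst det_planar_sheared) (auto simp: field_simps)
      ultimately show "F p \<in> T" using d by (simp add: T_def F_def p')
    qed
    have "T \<subseteq> {vs. set vs \<subseteq> (\<Union>j<d. G j) \<and> length vs = d}"
      by (auto simp: T_def in_set_conv_nth intro!: bexI)
    then show "finite T" using fin finite_lists_length_eq[of "\<Union>j<d. G j" d]
      by (meson finite_UN_I finite_lessThan finite_subset)
  qed
  moreover have "card ?D = k ^ (3 * d - 2)"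
  proof -
    have "card ?D = k * (k * (k ^ 2 * (k ^ 3) ^ (d - 2)))" by (simp add: card_cartesian_product W)
    also have "\<dots> = k ^ (4 + 3 * (d - 2))"
      by (simp add: power_add power_mult power2_eq_square power4_eq_xxxx)
    also have "4 + 3 * (d - 2) = 3 * d - 2" using d by simp
    finally show ?thesis .
  qed
  moreover have "card T \<le> max_unit_minors d n"
    unfolding T_def using d by (intro max_unit_minors_ge_classes fin carrier disj size) auto
  ultimately show ?thesis by simp
qed

lemma max_unit_minors_pos:
  assumes d: "d \<ge> 1" and n: "d \<le> n"
  shows "1 \<le> max_unit_minors d n"
proof -
  define G where "G j = {unit_vec d j :: real vec}" for j
  let ?T = "{vs. length vs = d \<and> (\<forall>j<d. vs ! j \<in> G j) \<and> det (mat_of_cols d vs) = 1}"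
  have "mat_of_cols d (map (unit_vec d) [0..<d]) = (1\<^sub>m d :: real mat)"
    by (rule eq_matI) (auto simp: mat_of_cols_index unit_vec_def)
  then have "map (unit_vec d) [0..<d] \<in> ?T" by (simp add: G_def)
  moreover have "finite ?T"
    by (rule finite_subset[OF _ finite_lists_length_eq[of "\<Union>j<d. G j" d]]) (auto simp: G_def in_set_conv_nth)
  ultimately have "1 \<le> card ?T"
    by (metis (no_types, lifting) One_nat_def Suc_leI card_gt_0_iff empty_iff)
  also have "\<dots> \<le> max_unit_minors d n"
  proof (rule max_unit_minors_ge_classes[OF d])
    fix i j assume ij: "i < j" "j < d"
    have "unit_vec d i $ j = (0 :: real)" "unit_vec d j $ j = (1 :: real)" using ij by auto
    then show "G i \<inter> G j = {}" by (auto simp: G_def)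
  qed (use n in \<open>auto simp: G_def\<close>)
  finally show ?thesis .
qed

text \<open>
  The construction is used with the largest \<open>k\<close> such that \<open>(d + 2) k^3 \<le> n\<close>. If \<open>n < d + 2\<close>, there
  is no such \<open>k \<ge> 1\<close>, and the unit vectors supply one unit minor.
\<close>
theorem max_unit_minors_lower:
  assumes d: "d \<ge> 2" and n: "d \<le> n"
  shows "real n powr (real d - 2 / 3) \<le> (8 * (real d + 2)) powr (real d - 2 / 3) * real (max_unit_minors d n)"
proof (cases "d + 2 \<le> n")
  case False
  then have "real n powr (real d - 2 / 3) \<le> (8 * (real d + 2)) powr (real d - 2 / 3) * 1"
    using d by (simp, intro powr_mono2) auto
  also have "\<dots> \<le> (8 * (real d + 2)) powr (real d - 2 / 3) * real (max_unit_minors d n)"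
    using max_unit_minors_pos[of d n] d n by (intro mult_left_mono) auto
  finally show ?thesis .
next
  case True
  define y k where "y = (real n / (real d + 2)) powr (1 / 3)" and "k = nat \<lfloor>y\<rfloor>"
  have "real n / (real d + 2) \<ge> 1" using True by (simp add: le_divide_eq)
  then have y1: "y \<ge> 1" and y3: "y ^ 3 = real n / (real d + 2)"
    by (simp_all add: y_def ge_one_powr_ge_zero powr_powr flip: powr_realpow)
  have "\<lfloor>y\<rfloor> \<ge> 1" using y1 by simp
  then have "real k = of_int \<lfloor>y\<rfloor>" "real k \<ge> 1" by (simp_all add: k_def)
  then have k: "k \<ge> 1" "real k \<le> y" "y \<le> 2 * real k" by linarith+
  have "real n = (real d + 2) * y ^ 3" by (simp add: y3)
  also have "\<dots> \<le> (real d + 2) * (2 * real k) ^ 3" using k y1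
    by (intro mult_left_mono power_mono) auto
  finally have nk: "real n \<le> 8 * (real d + 2) * real k ^ 3"
    by (simp add: power_mult_distrib algebra_simps)
  have "real ((d + 2) * k ^ 3) = (real d + 2) * real k ^ 3" by (simp add: algebra_simps)
  also have "\<dots> \<le> (real d + 2) * y ^ 3" using k by (intro mult_left_mono power_mono) auto
  also have "\<dots> = real n" by (simp add: y3)
  finally have "(d + 2) * k ^ 3 \<le> n" by (simp only: of_nat_le_iff)
  then have max: "k ^ (3 * d - 2) \<le> max_unit_minors d n" by (rule many_unit_minors[OF d k(1)])
  have "real n powr (real d - 2 / 3) \<le> (8 * (real d + 2) * real k ^ 3) powr (real d - 2 / 3)"
    using nk d by (intro powr_mono2) auto
  also have "\<dots> = (8 * (real d + 2)) powr (real d - 2 / 3) * (real k ^ 3) powr (real d - 2 / 3)"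
    by (simp add: powr_mult)
  also have "(real k ^ 3) powr (real d - 2 / 3) = real k powr (3 * real d - 2)"
  proof -
    have "real k ^ 3 = real k powr 3" using k powr_realpow[of "real k" 3] by simp
    then have "(real k ^ 3) powr (real d - 2 / 3) = real k powr (3 * (real d - 2 / 3))"
      by (simp only: powr_powr)
    then show ?thesis by (simp add: right_diff_distrib)
  qed
  also have "\<dots> = real (k ^ (3 * d - 2))"
  proof -
    have "real (3 * d - 2) = 3 * real d - 2" using d by (simp add: of_nat_diff)
    then show ?thesis using k powr_realpow[of "real k" "3 * d - 2"] by simp
  qed
  also have "(8 * (real d + 2)) powr (real d - 2 / 3) * \<dots> \<le> (8 * (real d + 2)) powr (real d - 2 / 3) * real (max_unit_minors d n)"
    using max by (intro mult_left_mono of_nat_mono) auto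
  finally show ?thesis .
qed

section \<open>The two bounds for the maximum\<close>

theorem max_unit_minors_upper:
  assumes d: "d \<ge> 1"
  shows "\<exists>C>0. \<forall>n. real (max_unit_minors d n) \<le> C * real n powr (real d - 2 / (real d + 1))"
proof -
  obtain C where C: "C > 0" "\<And>S. finite S
    \<Longrightarrow> S \<subseteq> carrier_vec d \<Longrightarrow>
      real (card (det_tuples d 1 S)) \<le> C * real (card S) powr (real d - 2 / (real d + 1))"
    using count_det_tuples[OF d] zero_neq_one by fastforce
  have "real (max_unit_minors d n) \<le> C * real n powr (real d - 2 / (real d + 1))" for n
  proof -
    have "max_unit_minors d n \<in> {card (unit_minors A) | A. A \<in> carrier_mat d n \<and> distinct (cols A)}"
      unfolding max_unit_minors_def
      by (rule Max_in[OF finite_unit_minor_counts unit_minor_counts_nonempty[OF d]])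
    then obtain A where A: "A \<in> carrier_mat d n" "distinct (cols A)" "max_unit_minors d n = card (unit_minors A)"
      by auto
    have S: "card (set (cols A)) = n" "set (cols A) \<subseteq> carrier_vec d"
      using A distinct_card[OF A(2)] cols_dim[of A] by auto
    have "real (max_unit_minors d n) \<le> real (card (det_tuples d 1 (set (cols A))))"
      using card_unit_minors_le_tuples[OF A(1,2)] A(3) by simp
    also have "\<dots> \<le> C * real n powr (real d - 2 / (real d + 1))" using C(2)[OF _ S(2)] S(1)
      by simp
    finally show ?thesis .
  qed
  then show ?thesis using C(1) by blast
qed

theorem theorem5p3:
  fixes d :: nat
  assumes "d \<ge> 2"
  shows "(\<exists>C>0. \<forall>n\<ge>d.
            real n powr (real d - 2 / 3) \<le> C * real (max_unit_minors d n)) \<and>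
         (\<forall>\<epsilon>>0. \<exists>C>0. \<forall>n\<ge>d.
            real (max_unit_minors d n)
              \<le> C * real n powr (real d - real d / ((real d)\<^sup>2 - real d + 1) + \<epsilon>))"
proof (intro conjI allI impI)
  show "\<exists>C>0. \<forall>n\<ge>d. real n powr (real d - 2 / 3) \<le> C * real (max_unit_minors d n)"
    using max_unit_minors_lower[OF assms]
    by (intro exI[of _ "(8 * (real d + 2)) powr (real d - 2 / 3)"]) auto
next
  fix \<epsilon> :: real assume \<epsilon>: "\<epsilon> > 0"
  obtain C where C: "C > 0" "\<And>n. real (max_unit_minors d n) \<le> C * real n powr (real d - 2 / (real d + 1))"
    using max_unit_minors_upper[of d] assms by auto
  \<comment> \<open>This inequality is the comparison of the two exponents, cleared of denominators.\<close>
  have "(real d - 1) * (real d - 2) \<ge> 0" using assms by simp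
  then have "real d * (real d + 1) \<le> 2 * ((real d)\<^sup>2 - real d + 1)"
    by (simp add: power2_eq_square algebra_simps)
  moreover have "(real d)\<^sup>2 - real d + 1 > 0"
    using assms by (simp add: power2_eq_square add_nonneg_pos)
  ultimately have "real d / ((real d)\<^sup>2 - real d + 1) \<le> 2 / (real d + 1)"
    by (simp add: divide_le_eq le_divide_eq mult.commute)
  then have "real d - 2 / (real d + 1) \<le> real d - real d / ((real d)\<^sup>2 - real d + 1) + \<epsilon>" using \<epsilon> by linarith
  then have "C * real n powr (real d - 2 / (real d + 1))
      \<le> C * real n powr (real d - real d / ((real d)\<^sup>2 - real d + 1) + \<epsilon>)" if "n \<ge> d" for n
    using that assms C(1) by (intro mult_left_mono powr_mono) auto
  then have "real (max_unit_minors d n) \<le> C * real n powr (real d - real d / ((real d)\<^sup>2 - real d + 1) + \<epsilon>)"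
    if "n \<ge> d" for n
    using C(2)[of n] that by (meson order_trans)
  then show "\<exists>C>0. \<forall>n\<ge>d. real (max_unit_minors d n)
      \<le> C * real n powr (real d - real d / ((real d)\<^sup>2 - real d + 1) + \<epsilon>)"
    using C(1) by blast
qed

end
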